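(* Let $d \geq 2$ and let $C \subset \mathbb{R}^d$ be a bounded convex domain with real analytic boundary. Then the tube domain $\Omega := C + i\mathbb{R}^d \subset \mathbb{C}^d$ is not biholomorphic to a bounded convex domain in $\mathbb{C}^d$.
   Context: A domain is a non-empty connected open set. Here $C + i\mathbb{R}^d = \{x+iy : x \in C,\ y \in \mathbb{R}^d\}$. "Real analytic boundary" means that $\partial C$ is a real analytic embedded hypersurface of $\mathbb{R}^d$. *)

theory Defs
  imports "HOL-Analysis.Analysis"
begin

definition is_domain :: "'a::topological_space set \<Rightarrow> bool" where
  "is_domain D \<longleftrightarrow> D \<noteq> {} \<and> connected D \<and> open D"

definition tube :: "(real ^ 'n) set \<Rightarrow> (complex ^ 'n) set" where
  "tube C = {(\<chi> j. of_real (x $ j) + \<i> * of_real (y $ j)) | x y. x \<in> C}"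

(* Complex Frechet differentiability at every point: has_derivative only gives a
   real-linear derivative, so linearity over the complex scalars is demanded separately.
   Meaningful for open U only. *)
definition holomorphic_map_on ::
    "(complex ^ 'n \<Rightarrow> complex ^ 'm) \<Rightarrow> (complex ^ 'n) set \<Rightarrow> bool" where
  "holomorphic_map_on f U \<longleftrightarrow>
     (\<forall>z\<in>U. \<exists>f'. (f has_derivative f') (at z) \<and> Vector_Spaces.linear (*s) (*s) f')"

definition biholomorphic :: "(complex ^ 'n) set \<Rightarrow> (complex ^ 'm) set \<Rightarrow> bool" where
  "biholomorphic U V \<longleftrightarrow>
     (\<exists>f g. holomorphic_map_on f U \<and> holomorphic_map_on g V \<and>
            f ` U \<subseteq> V \<and> g ` V \<subseteq> U \<and>
            (\<forall>z\<in>U. g (f z) = z) \<and> (\<forall>w\<in>V. f (g w) = w))"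

(* Near every point p of U, f is the sum of a convergent power series in x - p,
   indexed by the multi-indices \<alpha> :: 'n \<Rightarrow> nat. *)
definition real_analytic_on :: "(real ^ 'n \<Rightarrow> real) \<Rightarrow> (real ^ 'n) set \<Rightarrow> bool" where
  "real_analytic_on f U \<longleftrightarrow>
     (\<forall>p\<in>U. \<exists>a r. r > 0 \<and>
        (\<forall>x\<in>ball p r.
           ((\<lambda>\<alpha>. a \<alpha> * (\<Prod>i\<in>UNIV. (x $ i - p $ i) ^ \<alpha> i)) has_sum f x)
             (UNIV :: ('n \<Rightarrow> nat) set)))"

(* Embedded hypersurfaces are given by local defining functions with nonvanishing
   differential. *)
definition real_analytic_hypersurface :: "(real ^ 'n) set \<Rightarrow> bool" where
  "real_analytic_hypersurface S \<longleftrightarrow>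
     (\<forall>p\<in>S. \<exists>U \<rho>. open U \<and> p \<in> U \<and> real_analytic_on \<rho> U \<and>
        S \<inter> U = {x \<in> U. \<rho> x = 0} \<and>
        (\<forall>x\<in>U. \<exists>\<rho>'. (\<rho> has_derivative \<rho>') (at x) \<and> \<rho>' \<noteq> (\<lambda>v. 0)))"

end

theory Submission
  imports Defs "HOL-Complex_Analysis.Great_Picard"
begin

text \<open>
Let \<open>F\<close> map the tube \<open>\<Omega> = C + i\<real>\<^sup>d\<close> biholomorphically onto a bounded convex domain \<open>D\<close>, with inverse
\<open>H\<close>. The contradiction comes from comparing \<open>H'\<close>, at the point \<open>F z\<close>, with the distance of \<open>F z\<close> to
the complement of \<open>D\<close>, called its depth. A Koebe-type estimate (\<open>cderiv_inverse_lower\<close>) says that the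
norm of \<open>H'\<close> is at least a constant times 1/depth; the rest of the proof finds points where \<open>H'\<close>
is much smaller than that.

Convexity of \<open>D\<close> produces many self-maps of \<open>\<Omega>\<close>: for \<open>p\<close> in \<open>D\<close> and a function \<open>\<kappa>\<close> with values in a
narrow sector around the positive axis, \<open>w \<mapsto> w + t \<kappa> (p - w)\<close> preserves \<open>D\<close> for small \<open>t > 0\<close>
because \<open>D\<close> is bounded, and conjugating with \<open>F\<close> gives a holomorphic self-map of \<open>\<Omega>\<close> which for
\<open>t \<rightarrow> 0\<close> moves \<open>z\<close> in the direction \<open>\<kappa> H'(F z) (p - F z)\<close>. Now let \<open>n\<close> be a real covector and \<open>a\<close>,
\<open>a + v\<close> the points of the closure of \<open>C\<close> where it is minimal and maximal. The complex line through
these points meets \<open>\<Omega>\<close> in a strip, and \<open>n\<close> maps \<open>\<Omega>\<close> onto a strip of the same width, so every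
self-map of \<open>\<Omega>\<close> induces a self-map of a strip. By the Schwarz lemma such a map does not increase
distances on the axis of the strip, and this makes the imaginary part of the \<open>n\<close>-component of the
field above monotone along the axis (\<open>generator_monotone\<close>). If it tends to 0 at both ends it
vanishes. With \<open>\<kappa> = 1 / cos(c (\<zeta> - 1/2))\<close>, whose values stay in a narrow sector while it decays
like \<open>exp(-c |Im \<zeta>|)\<close>, decay at the ends only requires that 1/depth grows along \<open>v\<close> at a rate
smaller than \<open>c\<close> (\<open>normal_component_decay\<close>).

By Harnack's inequality 1/depth grows at most exponentially in the imaginary directions. Almost
maximising it against \<open>exp(-\<epsilon> |\<eta>|\<^sup>2)\<close> and letting \<open>\<epsilon> \<rightarrow> 0\<close> gives base points around which 1/depth is
bounded by a multiple of a single exponential \<open>exp(l \<bullet> \<eta>)\<close>, up to a factor \<open>exp(\<epsilon> |\<eta>|\<^sup>2)\<close>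
that tends to 1 (\<open>exponential_tilt\<close>).
If \<open>l \<bullet> v\<close> is small, the \<open>n\<close>-component of \<open>H'\<close> at the base points is therefore negligible compared
with 1/depth. Here the dimension and strict convexity enter: for \<open>d \<ge> 2\<close> there is a longest chord of
\<open>C\<close> orthogonal to \<open>l\<close>, its ends have opposite supporting hyperplanes, and by strict convexity
all covectors \<open>n\<close> near their common normal still give chords nearly orthogonal to \<open>l\<close>
(\<open>supporting_chords_nearly_orthogonal\<close>). For different \<open>n\<close> the estimate holds at different points of
\<open>C\<close>; Vitali's theorem moves it to one common point. An open set of covectors spans, so all of \<open>H'\<close> is
negligible, against the Koebe-type estimate.

Strict convexity follows from analyticity: a segment in the boundary would continue, by the identity
theorem, beyond the last point of its line in the closure of \<open>C\<close>.
\<close>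

section \<open>Schwarz lemmas for half-planes and strips\<close>

text \<open>Both parts are the Schwarz lemma for the composition of \<open>h\<close> with the Cayley transform that sends
\<open>h a\<close> to 0. All estimates for convex sets below are reduced to this lemma by supporting hyperplanes: a
real affine function that is positive on a convex set becomes, along a holomorphic curve in that set,
the real part of such an \<open>h\<close>.\<close>

lemma schwarz_right_half_plane:
  fixes h :: "complex \<Rightarrow> complex"
  assumes hol: "h holomorphic_on ball a r" and "0 < r"
    and pos: "\<And>z. z \<in> ball a r \<Longrightarrow> 0 < Re (h z)"
  shows "norm (deriv h a) \<le> 2 * Re (h a) / r"
    and "z \<in> cball a (r / 3) \<Longrightarrow> Re (h a) / 2 \<le> Re (h z)"
proof -
  define q where "q \<zeta> = (h (a + of_real r * \<zeta>) - h a) / (h (a + of_real r * \<zeta>) + cnj (h a))" for \<zeta>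
  have inb: "a + of_real r * \<zeta> \<in> ball a r" if "norm \<zeta> < 1" for \<zeta>
    using that \<open>0 < r\<close> by (auto simp: dist_norm norm_mult)
  have nz: "h z + cnj (h a) \<noteq> 0" if "z \<in> ball a r" for z
  proof -
    have "Re (h z + cnj (h a)) > 0"
      using pos[OF that] pos[of a] \<open>0 < r\<close> by simp
    then show ?thesis by (metis less_irrefl zero_complex.simps(1))
  qed
  have holc: "(\<lambda>\<zeta>. h (a + of_real r * \<zeta>)) holomorphic_on ball 0 1"
    by (rule holomorphic_on_compose_gen[OF _ hol, unfolded o_def])
       (auto intro!: holomorphic_intros inb)
  have holq: "q holomorphic_on ball 0 1"
    unfolding q_def by (intro holomorphic_intros holc) (auto intro!: nz inb)
  have q0: "q 0 = 0" by (simp add: q_def)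
  have ra: "Re (h a) > 0" using pos[of a] \<open>0 < r\<close> by simp
  have less: "norm (u - h a) < norm (u + cnj (h a))" if "Re u > 0" for u
  proof -
    have "(norm (u - h a))\<^sup>2 < (norm (u + cnj (h a)))\<^sup>2"
      using mult_pos_pos[OF that ra] unfolding cmod_power2
      by (simp add: power2_eq_square algebra_simps)
    then show ?thesis by (simp add: power2_less_imp_less)
  qed
  have q1: "norm (q \<zeta>) < 1" if "norm \<zeta> < 1" for \<zeta>
    using less[OF pos[OF inb[OF that]]] nz[OF inb[OF that]] by (simp add: q_def norm_divide divide_simps)
  have qz: "norm (q \<zeta>) \<le> norm \<zeta>" if "norm \<zeta> < 1" for \<zeta>
    by (rule Schwarz_Lemma(1)[OF holq q0 q1 that])
  have qd: "norm (deriv q 0) \<le> 1"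
    by (rule Schwarz_Lemma(2)[OF holq q0 q1, of 0]) auto
  have hd: "(h has_field_derivative deriv h a) (at a)"
    using holomorphic_derivI[OF hol open_ball, of a] \<open>0 < r\<close> by simp
  have hd': "((\<lambda>\<zeta>. h (a + of_real r * \<zeta>)) has_field_derivative deriv h a * of_real r) (at 0)"
    by (rule DERIV_chain2[where g="\<lambda>\<zeta>. a + of_real r * \<zeta>" and x=0])
       (use hd in \<open>auto intro!: derivative_eq_intros\<close>)
  have nza: "h a + cnj (h a) \<noteq> 0" using nz[of a] \<open>0 < r\<close> by simp
  have "(q has_field_derivative deriv h a * of_real r / (h a + cnj (h a))) (at 0)"
    unfolding q_def
    using DERIV_divide[OF DERIV_diff[OF hd' DERIV_const[of "h a"]] DERIV_add[OF hd' DERIV_const[of "cnj (h a)"]]] nza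
    by simp
  then have "deriv q 0 = deriv h a * of_real r / (h a + cnj (h a))"
    by (rule DERIV_imp_deriv)
  then have "norm (deriv q 0) = norm (deriv h a) * r / (2 * Re (h a))"
    using ra \<open>0 < r\<close> unfolding complex_add_cnj by (simp add: norm_divide norm_mult)
  then have "norm (deriv h a) * r \<le> 2 * Re (h a)"
    using qd ra mult_left_mono[OF qd, of "2 * Re (h a)"] by (simp add: field_simps)
  then show "norm (deriv h a) \<le> 2 * Re (h a) / r"
    using \<open>0 < r\<close> by (simp add: field_simps)
  assume z: "z \<in> cball a (r / 3)"
  define \<zeta> where "\<zeta> = (z - a) / of_real r"
  have z\<zeta>: "z = a + of_real r * \<zeta>" using \<open>0 < r\<close> by (simp add: \<zeta>_def)
  have n\<zeta>: "norm \<zeta> \<le> 1 / 3"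
    using z \<open>0 < r\<close> by (simp add: \<zeta>_def norm_divide dist_norm norm_minus_commute divide_simps)
  then have "norm (q \<zeta>) \<le> 1 / 3" using qz[of \<zeta>] by linarith
  moreover have "h z + cnj (h a) \<noteq> 0" using nz[OF inb[of \<zeta>]] n\<zeta> by (simp add: z\<zeta>)
  ultimately have "3 * norm (h z - h a) \<le> norm (h z + cnj (h a))"
    by (simp add: q_def z\<zeta> norm_divide divide_simps)
  then have "(3 * norm (h z - h a))\<^sup>2 \<le> (norm (h z + cnj (h a)))\<^sup>2"
    by (intro power_mono) auto
  then have f1: "9 * ((Re (h z) - Re (h a))\<^sup>2 + (Im (h z) - Im (h a))\<^sup>2)
       \<le> (Re (h z) + Re (h a))\<^sup>2 + (Im (h z) - Im (h a))\<^sup>2"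
    by (simp add: power_mult_distrib cmod_power2)
  have arith: "9 * (A + B) \<le> E + B \<Longrightarrow> G = 9 * A \<Longrightarrow> 0 \<le> B \<Longrightarrow> G \<le> E" for A B E G :: real
    by (simp add: distrib_left)
  have f2: "(3 * (Re (h a) - Re (h z)))\<^sup>2 = 9 * (Re (h z) - Re (h a))\<^sup>2"
    by (simp add: power2_eq_square algebra_simps)
  have f3: "(3 * (Re (h a) - Re (h z)))\<^sup>2 \<le> (Re (h z) + Re (h a))\<^sup>2"
    by (rule arith[OF f1 f2 zero_le_power2])
  have "Re (h z) > 0" using pos[OF inb[of \<zeta>]] n\<zeta> by (simp add: z\<zeta>)
  then have "3 * (Re (h a) - Re (h z)) \<le> Re (h z) + Re (h a)"
    using ra by (intro power2_le_imp_le[OF f3]) simp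
  then show "Re (h a) / 2 \<le> Re (h z)" by simp
qed

abbreviation unit_strip :: "complex set" where
  "unit_strip \<equiv> {\<zeta>. 0 < Re \<zeta> \<and> Re \<zeta> < 1}"

lemma open_unit_strip: "open unit_strip"
  by (intro open_Collect_conj open_Collect_less continuous_intros)

text \<open>The hyperbolic density of the strip at real part \<open>x\<close> is a multiple of \<open>1 / sin (pi x)\<close>, hence minimal
on the axis \<open>x = 1/2\<close>. A holomorphic self-map does not increase the hyperbolic length of tangent
vectors, so at a point of the axis it cannot increase the Euclidean length either.\<close>

lemma strip_self_map_deriv_le:
  fixes g :: "complex \<Rightarrow> complex"
  assumes hol: "g holomorphic_on unit_strip" and self: "g ` unit_strip \<subseteq> unit_strip"
    and mid: "Re \<zeta> = 1 / 2"
  shows "norm (deriv g \<zeta>) \<le> 1"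
proof -
  \<comment> \<open>The conformal map of the unit disc onto the strip that sends 0 to the given point of the axis.\<close>
  define L where "L s = \<zeta> + Ln ((1 + s) / (1 - s)) / (\<i> * of_real pi)" for s :: complex
  have rp: "Re ((1 + s) / (1 - s)) > 0" and ns: "1 - s \<noteq> 0" if "norm s < 1" for s :: complex
  proof -
    show n: "1 - s \<noteq> 0" using that by auto
    have "Re ((1 + s) / (1 - s)) = (1 - (norm s)\<^sup>2) / (norm (1 - s))\<^sup>2"
      unfolding cmod_power2 by (simp add: Re_divide) (simp add: power2_eq_square algebra_simps)
    moreover have "(norm s)\<^sup>2 < 1" using that by (simp add: power_less_one_iff abs_square_less_1)
    ultimately show "Re ((1 + s) / (1 - s)) > 0" using n by simp
  qed
  have notneg: "(1 + s) / (1 - s) \<notin> \<real>\<^sub>\<le>\<^sub>0" if "norm s < 1" for s :: complex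
    using rp[OF that] by (auto simp: complex_nonpos_Reals_iff)
  have Lmem: "L s \<in> unit_strip" if "norm s < 1" for s
  proof -
    have "(1 + s) / (1 - s) \<noteq> 0" using rp[OF that] by force
    then have "\<bar>Im (Ln ((1 + s) / (1 - s)))\<bar> < pi / 2" using rp[OF that] Re_Ln_pos_lt by blast
    then have "\<bar>Im (Ln ((1 + s) / (1 - s))) / pi\<bar> < 1 / 2" by (simp add: field_simps)
    moreover have "Re (L s) = 1 / 2 + Im (Ln ((1 + s) / (1 - s))) / pi"
      by (simp add: L_def mid Re_divide power2_eq_square)
    ultimately show ?thesis by (simp only: abs_less_iff mem_Collect_eq) linarith
  qed
  have holL: "L holomorphic_on ball 0 1"
    unfolding L_def by (intro holomorphic_intros) (auto simp: notneg ns)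
  \<comment> \<open>The map \<open>w \<mapsto> - \<i> exp (\<i> pi w)\<close> takes the strip to the right half-plane.\<close>
  define h where "h s = - \<i> * exp (\<i> * of_real pi * g (L s))" for s
  have holh: "h holomorphic_on ball 0 1"
    unfolding h_def
    by (intro holomorphic_intros holomorphic_on_compose_gen[OF holL hol, unfolded o_def]) (use Lmem in auto)
  have eq: "Re (- \<i> * exp (\<i> * of_real pi * w)) = exp (- pi * Im w) * sin (pi * Re w)" for w
    by (simp add: Re_exp Im_exp)
  have posh: "Re (h s) > 0" if "s \<in> ball 0 1" for s
  proof -
    have "g (L s) \<in> unit_strip" using Lmem[of s] that self by auto
    then have "sin (pi * Re (g (L s))) > 0" by (intro sin_gt_zero) auto
    then show ?thesis unfolding h_def eq by simp
  qed
  have \<zeta>s: "\<zeta> \<in> unit_strip" using mid by simp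
  have dg: "(g has_field_derivative deriv g \<zeta>) (at \<zeta>)"
    by (rule holomorphic_derivI[OF hol open_unit_strip \<zeta>s])
  have L0: "L 0 = \<zeta>" by (simp add: L_def)
  have dq: "((\<lambda>s. (1 + s) / (1 - s)) has_field_derivative 2) (at (0::complex))"
    by (rule derivative_eq_intros refl | simp)+
  have dL: "(L has_field_derivative 2 / (\<i> * of_real pi)) (at 0)"
    unfolding L_def using dq
    by (auto intro!: derivative_eq_intros)
  have dgL: "((\<lambda>s. g (L s)) has_field_derivative deriv g \<zeta> * (2 / (\<i> * of_real pi))) (at 0)"
    by (rule DERIV_chain2[OF _ dL]) (simp add: L0 dg)
  have "(h has_field_derivative - \<i> * (exp (\<i> * of_real pi * g \<zeta>) * (\<i> * of_real pi * (deriv g \<zeta> * (2 / (\<i> * of_real pi)))))) (at 0)"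
    unfolding h_def
    by (rule derivative_eq_intros dgL refl | simp add: L0)+
  then have "deriv h 0 = - \<i> * (exp (\<i> * of_real pi * g \<zeta>) * (\<i> * of_real pi * (deriv g \<zeta> * (2 / (\<i> * of_real pi)))))"
    by (rule DERIV_imp_deriv)
  then have nd: "norm (deriv h 0) = 2 * exp (- pi * Im (g \<zeta>)) * norm (deriv g \<zeta>)"
    by (simp add: norm_mult norm_divide)
  have "norm (deriv h 0) \<le> 2 * Re (h 0)"
    using schwarz_right_half_plane(1)[OF holh _ posh] by simp
  also have "Re (h 0) = exp (- pi * Im (g \<zeta>)) * sin (pi * Re (g \<zeta>))"
    unfolding h_def eq by (simp add: L0)
  also have "\<dots> \<le> exp (- pi * Im (g \<zeta>)) * 1" by (intro mult_left_mono) auto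
  finally show ?thesis unfolding nd by simp
qed

lemma strip_self_map_Im_le:
  fixes g :: "complex \<Rightarrow> complex"
  assumes hol: "g holomorphic_on unit_strip" and self: "g ` unit_strip \<subseteq> unit_strip"
    and "S \<le> T"
  shows "Im (g (Complex (1/2) T)) - Im (g (Complex (1/2) S)) \<le> T - S"
proof -
  have seg: "closed_segment (Complex (1/2) S) (Complex (1/2) T) \<subseteq> {z. Re z = 1 / 2}"
    by (auto simp: closed_segment_def diff_divide_distrib)
  have "norm (g (Complex (1/2) T) - g (Complex (1/2) S)) \<le> 1 * norm (Complex (1/2) T - Complex (1/2) S)"
  proof (rule field_differentiable_bound[where f' = "deriv g"])
    show "convex (closed_segment (Complex (1/2) S) (Complex (1/2) T))" by simp
    fix z assume "z \<in> closed_segment (Complex (1/2) S) (Complex (1/2) T)"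
    then have z: "Re z = 1 / 2" using seg by auto
    then show "norm (deriv g z) \<le> 1" by (rule strip_self_map_deriv_le[OF hol self])
    show "(g has_field_derivative deriv g z) (at z within closed_segment (Complex (1/2) S) (Complex (1/2) T))"
      by (rule has_field_derivative_at_within, rule holomorphic_derivI[OF hol open_unit_strip]) (use z in simp)
  qed auto
  moreover have "Complex (1/2) T - Complex (1/2) S = \<i> * of_real (T - S)"
    by (simp add: complex_eq_iff)
  ultimately have "norm (g (Complex (1/2) T) - g (Complex (1/2) S)) \<le> T - S"
    using \<open>S \<le> T\<close> by (simp only: norm_mult norm_of_real norm_ii)  simp
  moreover have "Im (g (Complex (1/2) T) - g (Complex (1/2) S)) \<le> norm (g (Complex (1/2) T) - g (Complex (1/2) S))"
    using abs_Im_le_cmod abs_le_D1 by blast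
  ultimately show ?thesis by simp
qed

text \<open>The weight that cuts off the generators at both ends of the strip. Its argument is at most about
\<open>c / 2\<close> on the whole strip, and on the axis it is \<open>1 / cosh (c T)\<close>.\<close>

definition strip_weight :: "real \<Rightarrow> complex \<Rightarrow> complex" where
  "strip_weight c \<zeta> = inverse (cos (of_real c * (\<zeta> - 1 / 2)))"

lemma strip_weight:
  assumes c: "0 < c" "c \<le> 1" and \<zeta>: "\<zeta> \<in> unit_strip"
  shows "cos (of_real c * (\<zeta> - 1 / 2)) \<noteq> 0"
    and "0 \<le> Re (strip_weight c \<zeta>)" and "Re (strip_weight c \<zeta>) \<le> 2"
    and "\<bar>Im (strip_weight c \<zeta>)\<bar> \<le> c * Re (strip_weight c \<zeta>)"
proof -
  define s t where "s = c * (Re \<zeta> - 1 / 2)" and "t = c * Im \<zeta>"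
  define z where "z = cos (of_real c * (\<zeta> - 1 / 2))"
  have Rez: "Re z = cos s * cosh t"
    unfolding z_def by (simp add: Re_cos s_def t_def cosh_def field_simps)
  have Imz: "Im z = - (sin s * sinh t)"
    unfolding z_def by (simp add: Im_cos s_def t_def sinh_def field_simps)
  have "\<bar>Re \<zeta> - 1 / 2\<bar> \<le> 1 / 2" using \<zeta> by (intro abs_leI) auto
  then have s: "\<bar>s\<bar> \<le> c / 2"
    using c(1) mult_left_mono[of "\<bar>Re \<zeta> - 1/2\<bar>" "1/2" c] by (simp add: s_def abs_mult)
  have "cos (pi / 3) \<le> cos \<bar>s\<bar>"
    using s c pi_gt3 by (intro cos_monotone_0_pi_le) auto
  then have cs: "1 / 2 \<le> cos s" by (simp add: cos_60)
  have ch: "1 \<le> cosh t" by (rule cosh_real_ge_1)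
  have "1 / 2 * 1 \<le> cos s * cosh t" by (rule mult_mono) (use cs ch in auto)
  then have R: "1 / 2 \<le> Re z" unfolding Rez by simp
  then show "cos (of_real c * (\<zeta> - 1 / 2)) \<noteq> 0" by (auto simp: z_def)
  have w: "Re (strip_weight c \<zeta>) = Re z / (norm z)\<^sup>2" "Im (strip_weight c \<zeta>) = - Im z / (norm z)\<^sup>2"
    unfolding strip_weight_def z_def[symmetric] by (simp_all add: cmod_power2)
  show "0 \<le> Re (strip_weight c \<zeta>)" unfolding w using R by simp
  have nz: "norm z > 0" using R by auto
  have "Re z * Re z \<le> (norm z)\<^sup>2" unfolding cmod_power2 by (simp add: power2_eq_square)
  moreover have "Re z \<le> 2 * (Re z * Re z)" using R mult_right_mono[OF R, of "Re z"] by simp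
  ultimately have "Re z \<le> 2 * (norm z)\<^sup>2" by linarith
  then show "Re (strip_weight c \<zeta>) \<le> 2" unfolding w using nz by (simp add: divide_le_eq)
  have "\<bar>sin s\<bar> \<le> c / 2" using abs_sin_x_le_abs_x[of s] s by linarith
  also have "c / 2 \<le> c * cos s" using c(1) cs by simp
  finally have 1: "\<bar>sin s\<bar> \<le> c * cos s" .
  have "\<bar>sinh t\<bar> \<le> cosh t"
    using sinh_less_cosh_real[of t] sinh_less_cosh_real[of "- t"] by (simp add: abs_le_iff)
  then have "\<bar>sin s\<bar> * \<bar>sinh t\<bar> \<le> (c * cos s) * cosh t"
    using 1 by (intro mult_mono) auto
  then have "\<bar>Im z\<bar> \<le> c * Re z" unfolding Rez Imz by (simp add: abs_mult mult.assoc)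
  then show "\<bar>Im (strip_weight c \<zeta>)\<bar> \<le> c * Re (strip_weight c \<zeta>)"
    unfolding w using nz by (simp add: divide_right_mono)
qed

lemma strip_weight_holomorphic:
  "0 < c \<Longrightarrow> c \<le> 1 \<Longrightarrow> strip_weight c holomorphic_on unit_strip"
  unfolding strip_weight_def[abs_def] by (intro holomorphic_intros strip_weight(1)) auto

lemma strip_weight_mid: "strip_weight c (Complex (1/2) T) = of_real (inverse (cosh (c * T)))"
proof -
  have "of_real c * (Complex (1/2) T - 1 / 2) = \<i> * of_real (c * T)"
    by (simp add: complex_eq_iff)
  then have "strip_weight c (Complex (1/2) T) = inverse (cos (\<i> * of_real (c * T)))"
    by (simp only: strip_weight_def)
  also have "cos (\<i> * of_real (c * T)) = cosh (of_real (c * T))"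
    by (simp only: cosh_conv_cos)
  also have "\<dots> = of_real (cosh (c * T))"
    by (simp only: cosh_field_def exp_of_real[symmetric] of_real_add of_real_divide of_real_minus of_real_numeral)
  finally show ?thesis by (simp only: of_real_inverse)
qed

lemma inverse_cosh_le: "inverse (cosh x) \<le> 2 * exp (- x)" for x :: real
proof -
  have "1 = exp (- x) * exp x" by (simp flip: exp_add)
  also have "\<dots> \<le> exp (- x) * (2 * cosh x)"
    unfolding cosh_field_def by (intro mult_left_mono) auto
  finally have "1 \<le> (2 * exp (- x)) * cosh x" by (simp only: mult_ac)
  then show ?thesis using cosh_real_pos[of x] by (simp only: inverse_eq_divide divide_le_eq) simp
qed

section \<open>Normal families\<close>

text \<open>The Vitali--Porter theorem for the limit 0. By Montel's theorem every subsequence has a further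
subsequence with a holomorphic limit, which vanishes on \<open>E\<close> and hence on \<open>S\<close>.\<close>

lemma vitali_tendsto_zero:
  fixes f :: "nat \<Rightarrow> complex \<Rightarrow> complex"
  assumes S: "open S" "connected S"
    and hol: "\<And>j. f j holomorphic_on S"
    and bdd: "\<And>K. \<lbrakk>compact K; K \<subseteq> S\<rbrakk> \<Longrightarrow> \<exists>B. \<forall>j. \<forall>z\<in>K. norm (f j z) \<le> B"
    and E: "E \<subseteq> S" "\<xi> \<in> S" "\<xi> islimpt E"
    and lim: "\<And>z. z \<in> E \<Longrightarrow> (\<lambda>j. f j z) \<longlonglongrightarrow> 0"
    and z: "z \<in> S"
  shows "(\<lambda>j. f j z) \<longlonglongrightarrow> 0"
proof (rule ccontr)
  assume "\<not> (\<lambda>j. f j z) \<longlonglongrightarrow> 0"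
  then obtain e where e: "e > 0" and "\<not> (\<forall>\<^sub>F j in sequentially. dist (f j z) 0 < e)"
    unfolding tendsto_iff by auto
  then have "\<exists>\<^sub>F j in sequentially. \<not> dist (f j z) 0 < e"
    by (simp add: not_eventually)
  then have "infinite {j. \<not> dist (f j z) 0 < e}"
    unfolding cofinite_eq_sequentially[symmetric] by (simp add: frequently_cofinite)
  then obtain s where s: "strict_mono (s :: nat \<Rightarrow> nat)" "\<And>k. s k \<in> {j. \<not> dist (f j z) 0 < e}"
    using infinite_enumerate by blast
  obtain g r where g: "g holomorphic_on S" "strict_mono (r :: nat \<Rightarrow> nat)"
      "\<And>x. x \<in> S \<Longrightarrow> (\<lambda>n. f (s (r n)) x) \<longlonglongrightarrow> g x"
  proof (rule Montel[of S "range f" "\<lambda>n. f (s n)"])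
    fix K assume K: "compact K" "K \<subseteq> S"
    then show "\<exists>B. \<forall>h\<in>range f. \<forall>z\<in>K. norm (h z) \<le> B" using bdd[OF K] by auto
  qed (use S hol in auto)
  have sub: "filterlim (\<lambda>n. s (r n)) sequentially sequentially"
    using filterlim_subseq strict_mono_o[OF s(1) g(2)] by (simp add: o_def filterlim_subseq)
  have "g x = 0" if "x \<in> E" for x
    using LIMSEQ_unique[OF g(3) filterlim_compose[OF lim[OF that] sub]] that E(1) by blast
  then have "g z = 0"
    using analytic_continuation[OF g(1) S E(1,2,3) _ z] by blast
  with g(3)[OF z] have "(\<lambda>n. f (s (r n)) z) \<longlonglongrightarrow> 0" by simp
  then have "\<forall>\<^sub>F n in sequentially. dist (f (s (r n)) z) 0 < e" using e tendstoD by blast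
  then show False using s(2) by (auto simp: eventually_sequentially)
qed

text \<open>Local boundedness makes pointwise convergence enough, since the pointwise limit is also the limit of
a locally uniformly convergent subsequence.\<close>

lemma holomorphic_pointwise_limit:
  fixes f :: "nat \<Rightarrow> complex \<Rightarrow> complex"
  assumes S: "open S"
    and hol: "\<And>j. f j holomorphic_on S"
    and bdd: "\<And>K. \<lbrakk>compact K; K \<subseteq> S\<rbrakk> \<Longrightarrow> \<exists>B. \<forall>j. \<forall>z\<in>K. norm (f j z) \<le> B"
    and lim: "\<And>z. z \<in> S \<Longrightarrow> (\<lambda>j. f j z) \<longlonglongrightarrow> g z"
  shows "g holomorphic_on S"
proof -
  obtain h r where h: "h holomorphic_on S" "strict_mono (r :: nat \<Rightarrow> nat)"
      "\<And>x. x \<in> S \<Longrightarrow> (\<lambda>n. f (r n) x) \<longlonglongrightarrow> h x"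
  proof (rule Montel[of S "range f" f])
    fix K assume K: "compact K" "K \<subseteq> S"
    then show "\<exists>B. \<forall>h\<in>range f. \<forall>z\<in>K. norm (h z) \<le> B" using bdd[OF K] by auto
  qed (use S hol in auto)
  have "h x = g x" if "x \<in> S" for x
    using LIMSEQ_unique[OF h(3)[OF that] filterlim_compose[OF lim[OF that] filterlim_subseq[OF h(2)]]] by simp
  then show ?thesis using h(1) holomorphic_cong by (metis (no_types, lifting))
qed

section \<open>Complex lines and holomorphic maps of several variables\<close>

lemma norm_cscale: "norm (h *s u) = norm h * norm (u :: complex ^ 'n)"
  by (simp add: norm_vec_def norm_mult L2_set_right_distrib)

lemma bounded_bilinear_cscale: "bounded_bilinear (\<lambda>(h::complex) (u::complex ^ 'n). h *s u)"
proof
  fix a b :: complex and u v :: "complex ^ 'n" and r :: real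
  show "(a + b) *s u = a *s u + b *s u" "a *s (u + v) = a *s u + a *s v"
    by (simp_all add: vec_eq_iff algebra_simps)
  show "(r *\<^sub>R a) *s u = r *\<^sub>R (a *s u)" "a *s (r *\<^sub>R u) = r *\<^sub>R (a *s u)"
    by (simp_all add: vec_eq_iff)
  show "\<exists>K. \<forall>a (b::complex^'n). norm (a *s b) \<le> norm a * norm b * K"
    by (rule exI[of _ 1]) (simp add: norm_cscale)
qed

text \<open>A curve with complex parameter and complex derivative \<open>u\<close>. Restricting to such curves replaces
the function theory of several variables by that of one variable throughout.\<close>

abbreviation curve_deriv :: "(complex \<Rightarrow> complex ^ 'n) \<Rightarrow> complex ^ 'n \<Rightarrow> complex \<Rightarrow> bool" where
  "curve_deriv c u \<zeta> \<equiv> (c has_derivative (\<lambda>h. h *s u)) (at \<zeta>)"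

lemma curve_deriv_affine: "curve_deriv (\<lambda>\<zeta>. p + \<zeta> *s u) u \<zeta>"
  by (auto intro!: derivative_eq_intros bounded_linear_imp_has_derivative
      bounded_bilinear.bounded_linear_left[OF bounded_bilinear_cscale])

lemma curve_deriv_diff:
  "curve_deriv c u \<zeta> \<Longrightarrow> curve_deriv d v \<zeta> \<Longrightarrow> curve_deriv (\<lambda>\<zeta>. c \<zeta> - d \<zeta>) (u - v) \<zeta>"
  by (drule (1) has_derivative_diff) (simp add: vector_ssub_ldistrib)

lemma curve_deriv_add:
  "curve_deriv c u \<zeta> \<Longrightarrow> curve_deriv d v \<zeta> \<Longrightarrow> curve_deriv (\<lambda>\<zeta>. c \<zeta> + d \<zeta>) (u + v) \<zeta>"
  by (drule (1) has_derivative_add) (simp add: vector_add_ldistrib)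

lemma curve_deriv_const: "curve_deriv (\<lambda>\<zeta>. p) 0 \<zeta>"
  by simp

lemma curve_deriv_cscale:
  assumes "(\<kappa> has_field_derivative \<kappa>') (at \<zeta>)" and "curve_deriv c u \<zeta>"
  shows "curve_deriv (\<lambda>\<zeta>. \<kappa> \<zeta> *s c \<zeta>) (\<kappa> \<zeta> *s u + \<kappa>' *s c \<zeta>) \<zeta>"
proof -
  have "((\<lambda>\<zeta>. \<kappa> \<zeta> *s c \<zeta>) has_derivative (\<lambda>h. \<kappa> \<zeta> *s (h *s u) + (\<kappa>' * h) *s c \<zeta>)) (at \<zeta>)"
    using bounded_bilinear.FDERIV[OF bounded_bilinear_cscale
        assms(1)[unfolded has_field_derivative_def] assms(2)] .
  then show ?thesis
    by (rule has_derivative_eq_rhs) (auto simp: fun_eq_iff vec_eq_iff algebra_simps)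
qed

lemma curve_deriv_component:
  assumes "curve_deriv c u \<zeta>"
  shows "((\<lambda>\<zeta>. c \<zeta> $ i) has_field_derivative u $ i) (at \<zeta>)"
  unfolding has_field_derivative_def
  by (rule has_derivative_eq_rhs[OF bounded_linear.has_derivative[OF bounded_linear_vec_nth assms]])
     (auto simp: fun_eq_iff)

text \<open>The complex-linear extension of the real covector \<open>a\<close>.\<close>

definition cdot :: "real ^ 'n \<Rightarrow> complex ^ 'n \<Rightarrow> complex" where
  "cdot a z = (\<Sum>i\<in>UNIV. of_real (a $ i) * z $ i)"

definition re_vec :: "complex ^ 'n \<Rightarrow> real ^ 'n" where
  "re_vec z = (\<chi> i. Re (z $ i))"

definition cvec :: "real ^ 'n \<Rightarrow> real ^ 'n \<Rightarrow> complex ^ 'n" where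
  "cvec x y = (\<chi> i. Complex (x $ i) (y $ i))"

lemma cdot_linear:
  "cdot a (z + w) = cdot a z + cdot a w" "cdot a (z - w) = cdot a z - cdot a w"
  "cdot a (c *s z) = c * cdot a z" "cdot (a + b) z = cdot a z + cdot b z"
  "cdot (r *\<^sub>R a) z = of_real r * cdot a z"
  by (simp_all add: cdot_def algebra_simps sum.distrib sum_subtractf sum_distrib_left)

lemma cdot_axis: "cdot (axis i 1) z = z $ i"
proof -
  have "cdot (axis i 1) z = (\<Sum>j\<in>UNIV. if j = i then z $ j else 0)"
    unfolding cdot_def by (rule sum.cong) (auto simp: axis_def)
  then show ?thesis by simp
qed

lemma Re_cdot: "Re (cdot a z) = a \<bullet> re_vec z"
  by (simp add: cdot_def re_vec_def inner_vec_def)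

lemma cdot_cvec: "cdot a (cvec x y) = Complex (a \<bullet> x) (a \<bullet> y)"
  by (simp add: cdot_def cvec_def inner_vec_def complex_eq_iff)

lemma norm_cdot_le: "norm (cdot a z) \<le> norm a * norm z"
proof -
  have "norm (cdot a z) \<le> (\<Sum>i\<in>UNIV. norm (a $ i) * norm (z $ i))"
    unfolding cdot_def by (rule order_trans[OF norm_sum]) (simp add: norm_mult)
  also have "\<dots> \<le> norm a * norm z"
    unfolding norm_vec_def using L2_set_mult_ineq[of "\<lambda>i. norm (a $ i)" "\<lambda>i. norm (z $ i)" UNIV] by simp
  finally show ?thesis .
qed

lemma re_vec_linear: "re_vec (z + w) = re_vec z + re_vec w" "re_vec (z - w) = re_vec z - re_vec w"
  "re_vec (r *\<^sub>R z) = r *\<^sub>R re_vec z"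
  by (simp_all add: re_vec_def vec_eq_iff)

lemma re_vec_cvec [simp]: "re_vec (cvec x y) = x"
  by (simp add: re_vec_def cvec_def)

lemma norm_re_vec_le: "norm (re_vec z) \<le> norm z"
  unfolding norm_vec_def by (rule L2_set_mono) (simp_all add: re_vec_def abs_Re_le_cmod)

lemma bounded_linear_re_vec: "bounded_linear re_vec"
  by (rule bounded_linear_intro[of _ 1]) (simp_all add: re_vec_linear norm_re_vec_le)

lemma cvec_linear: "cvec x y + cvec x' y' = cvec (x + x') (y + y')"
  "cvec x y - cvec x' y' = cvec (x - x') (y - y')"
  "r *\<^sub>R cvec x y = cvec (r *\<^sub>R x) (r *\<^sub>R y)"
  "\<zeta> *s cvec x 0 = cvec (Re \<zeta> *\<^sub>R x) (Im \<zeta> *\<^sub>R x)"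
  by (simp_all add: cvec_def vec_eq_iff complex_eq_iff)

lemma norm_cvec_le: "norm (cvec x y) \<le> norm x + norm y"
proof -
  have "norm (cvec x 0) = norm x" "norm (cvec 0 y) = norm y"
    unfolding norm_vec_def by (rule arg_cong[where f="\<lambda>f. L2_set f UNIV"], simp add: cvec_def fun_eq_iff cmod_def)+
  then show ?thesis using norm_triangle_ineq[of "cvec x 0" "cvec 0 y"] by (simp add: cvec_linear)
qed

lemma tube_eq: "tube C = {z. re_vec z \<in> C}"
proof -
  have "z \<in> tube C" if "re_vec z \<in> C" for z
    unfolding tube_def using that
    by (intro CollectI exI[of _ "re_vec z"] exI[of _ "\<chi> i. Im (z $ i)"])
       (simp add: vec_eq_iff complex_eq_iff re_vec_def)
  moreover have "re_vec z \<in> C" if "z \<in> tube C" for z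
    using that unfolding tube_def by (auto simp: re_vec_def)
  ultimately show ?thesis by blast
qed

lemma open_tube: "open C \<Longrightarrow> open (tube C)"
  using open_vimage[OF _ linear_continuous_on[OF bounded_linear_re_vec], of C]
  by (simp add: tube_eq vimage_def)

lemma ball_subset_tube:
  assumes "ball (re_vec z) r \<subseteq> C" shows "ball z r \<subseteq> tube C"
proof
  fix w assume "w \<in> ball z r"
  then have "norm (re_vec (z - w)) < r"
    using norm_re_vec_le[of "z - w"] by (simp add: dist_norm)
  then have "re_vec w \<in> ball (re_vec z) r" by (simp add: re_vec_linear dist_norm)
  then show "w \<in> tube C" using assms by (auto simp: tube_eq)
qed

definition cderiv :: "(complex ^ 'n \<Rightarrow> complex ^ 'm) \<Rightarrow> complex ^ 'n \<Rightarrow> complex ^ 'n \<Rightarrow> complex ^ 'm" where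
  "cderiv f z = frechet_derivative f (at z)"

lemma cderiv:
  assumes "holomorphic_map_on f U" "z \<in> U"
  shows "(f has_derivative cderiv f z) (at z)"
    and "cderiv f z (c *s e) = c *s cderiv f z e"
    and "cderiv f z (d + e) = cderiv f z d + cderiv f z e"
    and "cderiv f z (d - e) = cderiv f z d - cderiv f z e"
proof -
  obtain f' where f': "(f has_derivative f') (at z)" "Vector_Spaces.linear (*s) (*s) f'"
    using assms unfolding holomorphic_map_on_def by blast
  have eq: "cderiv f z = f'" unfolding cderiv_def using f'(1) by (metis frechet_derivative_at)
  show "(f has_derivative cderiv f z) (at z)" using f'(1) eq by simp
  show "cderiv f z (c *s e) = c *s cderiv f z e"
    using f'(2) unfolding eq by (simp add: linear_iff Vector_Spaces.linear_iff)
  show "cderiv f z (d + e) = cderiv f z d + cderiv f z e"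
    using f'(2) unfolding eq by (simp add: linear_iff Vector_Spaces.linear_iff)
  have "linear f'" using f'(1) has_derivative_linear by blast
  then show "cderiv f z (d - e) = cderiv f z d - cderiv f z e"
    unfolding eq by (rule linear_diff)
qed

lemma curve_deriv_compose:
  assumes "holomorphic_map_on f U" "c \<zeta> \<in> U" "curve_deriv c u \<zeta>"
  shows "curve_deriv (\<lambda>\<zeta>. f (c \<zeta>)) (cderiv f (c \<zeta>) u) \<zeta>"
  using diff_chain_at[OF assms(3) cderiv(1)[OF assms(1,2)]]
  by (simp add: o_def cderiv(2)[OF assms(1,2)])

lemma inner_curve_deriv:
  fixes a :: "complex ^ 'n"
  assumes "curve_deriv c u \<zeta>"
  shows "((\<lambda>\<zeta>. \<Sum>i\<in>UNIV. cnj (a $ i) * c \<zeta> $ i) has_field_derivative (\<Sum>i\<in>UNIV. cnj (a $ i) * u $ i)) (at \<zeta>)"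
  by (intro DERIV_sum DERIV_cmult curve_deriv_component assms)

lemma inner_eq_Re: "a \<bullet> w = Re (\<Sum>i\<in>UNIV. cnj (a $ i) * (w :: complex ^ 'n) $ i)"
  by (simp add: inner_vec_def inner_complex_def)

lemma cdot_curve_deriv:
  assumes "curve_deriv c u \<zeta>"
  shows "((\<lambda>\<zeta>. cdot a (c \<zeta>)) has_field_derivative cdot a u) (at \<zeta>)"
  unfolding cdot_def by (intro DERIV_sum DERIV_cmult curve_deriv_component assms)

lemma holomorphic_on_curve:
  assumes "open S" and "\<And>\<zeta>. \<zeta> \<in> S \<Longrightarrow> \<exists>u. curve_deriv c u \<zeta>"
  shows "(\<lambda>\<zeta>. cdot a (c \<zeta>)) holomorphic_on S"
    and "(\<lambda>\<zeta>. \<Sum>i\<in>UNIV. cnj (b $ i) * c \<zeta> $ i) holomorphic_on S"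
    and "(\<lambda>\<zeta>. c \<zeta> $ i) holomorphic_on S"
  unfolding holomorphic_on_open[OF assms(1)]
  using assms(2) cdot_curve_deriv inner_curve_deriv curve_deriv_component by blast+

text \<open>Used at \<open>t = 0\<close>, where the family of self-maps starts at the identity and only \<open>t > 0\<close> is available.\<close>

lemma right_derivative_nonneg:
  assumes d: "(f has_real_derivative d) (at 0)" and "h0 > 0"
    and ge: "\<And>t. 0 < t \<Longrightarrow> t \<le> h0 \<Longrightarrow> f 0 \<le> f t"
  shows "0 \<le> d"
proof (rule ccontr)
  assume "\<not> 0 \<le> d"
  then obtain e where e: "e > 0" "\<And>h. 0 < h \<Longrightarrow> h < e \<Longrightarrow> f (0 + h) < f 0"
    using DERIV_neg_dec_right[OF d] by auto
  have "f (0 + min (e / 2) h0) < f 0" by (rule e(2)) (use e \<open>h0 > 0\<close> in auto)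
  moreover have "f 0 \<le> f (min (e / 2) h0)" by (rule ge) (use e \<open>h0 > 0\<close> in auto)
  ultimately show False by simp
qed

lemma Im_along_reals_derivative:
  assumes "(f has_field_derivative d) (at 0)"
  shows "((\<lambda>t. Im (f (of_real t))) has_real_derivative Im d) (at 0)"
proof -
  have "((\<lambda>t. f (of_real t)) has_vector_derivative d) (at 0)"
    using has_vector_derivative_real_field[of f d 0 UNIV] assms by simp
  then have "((\<lambda>t. Im (f (of_real t))) has_vector_derivative Im d) (at 0)"
    by (rule bounded_linear.has_vector_derivative[OF bounded_linear_Im])
  then show ?thesis by (simp add: has_real_derivative_iff_has_vector_derivative)
qed

section \<open>Analytic boundaries and strict convexity\<close>

lemma finite_multi_indices:
  "finite {\<alpha> :: 'n::finite \<Rightarrow> nat. (\<Sum>i\<in>UNIV. \<alpha> i) = k}"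
proof (rule finite_subset)
  show "{\<alpha> :: 'n \<Rightarrow> nat. (\<Sum>i\<in>UNIV. \<alpha> i) = k} \<subseteq> (\<Pi>\<^sub>E i \<in> UNIV. {..k})"
    by (auto simp: PiE_def Pi_def extensional_def intro: member_le_sum)
  show "finite (\<Pi>\<^sub>E i \<in> (UNIV :: 'n set). {..k})"
    by (intro finite_PiE) auto
qed

text \<open>Along a line the monomial with multi-index \<open>\<alpha>\<close> becomes a multiple of \<open>t ^ |\<alpha>|\<close>, and there are
finitely many multi-indices of each order, so the terms can be collected into an ordinary power series.\<close>

lemma real_analytic_on_line:
  fixes \<rho> :: "real ^ 'n \<Rightarrow> real"
  assumes "real_analytic_on \<rho> U" "q \<in> U"
  obtains c r where "r > 0"
    and "\<And>t. norm (t *\<^sub>R u) < r \<Longrightarrow> (\<lambda>k. c k * t ^ k) sums \<rho> (q + t *\<^sub>R u)"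
proof -
  obtain b r where r: "r > 0" and b: "\<And>x. x \<in> ball q r \<Longrightarrow>
      ((\<lambda>\<alpha>. b \<alpha> * (\<Prod>i\<in>UNIV. (x $ i - q $ i) ^ \<alpha> i)) has_sum \<rho> x) (UNIV :: ('n \<Rightarrow> nat) set)"
    using assms unfolding real_analytic_on_def by blast
  define A where "A k = {\<alpha> :: 'n \<Rightarrow> nat. (\<Sum>i\<in>UNIV. \<alpha> i) = k}" for k
  define m where "m \<alpha> = b \<alpha> * (\<Prod>i\<in>UNIV. (u $ i) ^ \<alpha> i)" for \<alpha>
  have "(\<lambda>k. sum m (A k) * t ^ k) sums \<rho> (q + t *\<^sub>R u)" if t: "norm (t *\<^sub>R u) < r" for t
  proof -
    have "((\<lambda>\<alpha>. m \<alpha> * t ^ (\<Sum>i\<in>UNIV. \<alpha> i)) has_sum \<rho> (q + t *\<^sub>R u)) UNIV"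
    proof (rule has_sum_cong[THEN iffD1, OF _ b])
      show "q + t *\<^sub>R u \<in> ball q r" using t by (simp add: dist_norm)
      fix \<alpha> :: "'n \<Rightarrow> nat"
      show "b \<alpha> * (\<Prod>i\<in>UNIV. ((q + t *\<^sub>R u) $ i - q $ i) ^ \<alpha> i) = m \<alpha> * t ^ (\<Sum>i\<in>UNIV. \<alpha> i)"
        by (simp add: m_def power_mult_distrib prod.distrib power_sum mult_ac)
    qed
    moreover have "bij_betw snd (Sigma UNIV A) (UNIV :: ('n \<Rightarrow> nat) set)"
      by (rule bij_betwI[where g="\<lambda>\<alpha>. (\<Sum>i\<in>UNIV. \<alpha> i, \<alpha>)"]) (auto simp: A_def)
    ultimately have "((\<lambda>x. m (snd x) * t ^ (\<Sum>i\<in>UNIV. snd x i)) has_sum \<rho> (q + t *\<^sub>R u)) (Sigma UNIV A)"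
      by (simp add: has_sum_reindex_bij_betw[where f="\<lambda>\<alpha>. m \<alpha> * t ^ (\<Sum>i\<in>UNIV. \<alpha> i)"])
    then have sig: "((\<lambda>x. m (snd x) * t ^ (\<Sum>i\<in>UNIV. snd x i)) has_sum \<rho> (q + t *\<^sub>R u)) (Sigma UNIV A)" .
    have inner: "((\<lambda>\<alpha>. m \<alpha> * t ^ (\<Sum>i\<in>UNIV. \<alpha> i)) has_sum sum m (A k) * t ^ k) (A k)" for k
    proof -
      have "(\<Sum>\<alpha>\<in>A k. m \<alpha> * t ^ (\<Sum>i\<in>UNIV. \<alpha> i)) = (\<Sum>\<alpha>\<in>A k. m \<alpha> * t ^ k)"
        by (rule sum.cong) (simp_all add: A_def)
      also have "\<dots> = sum m (A k) * t ^ k" by (rule sum_distrib_right[symmetric])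
      finally have eq: "sum m (A k) * t ^ k = (\<Sum>\<alpha>\<in>A k. m \<alpha> * t ^ (\<Sum>i\<in>UNIV. \<alpha> i))" ..
      have fin: "finite (A k)" unfolding A_def by (rule finite_multi_indices)
      show ?thesis unfolding eq by (rule has_sum_finite[OF fin])
    qed
    have "((\<lambda>k. sum m (A k) * t ^ k) has_sum \<rho> (q + t *\<^sub>R u)) UNIV"
      by (rule has_sum_SigmaD[where g="\<lambda>k. sum m (A k) * t ^ k", OF sig])
         (simp only: snd_conv inner)
    then show ?thesis by (rule has_sum_imp_sums)
  qed
  then show ?thesis by (rule that[OF r])
qed

text \<open>The identity theorem on a line: a power series that vanishes on one side of its centre has only zero
coefficients.\<close>

lemma real_analytic_zero_extends:
  fixes \<rho> :: "real ^ 'n \<Rightarrow> real"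
  assumes an: "real_analytic_on \<rho> U" "q \<in> U" and "d > 0"
    and zero: "\<And>t. - d < t \<Longrightarrow> t \<le> 0 \<Longrightarrow> \<rho> (q + t *\<^sub>R u) = 0"
  shows "\<forall>\<^sub>F t in at_right 0. \<rho> (q + t *\<^sub>R u) = 0"
proof -
  obtain c r where r: "r > 0"
    and c: "\<And>t. norm (t *\<^sub>R u) < r \<Longrightarrow> (\<lambda>k. c k * t ^ k) sums \<rho> (q + t *\<^sub>R u)"
    using real_analytic_on_line[OF an, of u] by blast
  define r' where "r' = r / (norm u + 1)"
  have r': "r' > 0" using r norm_ge_zero[of u] by (simp add: r'_def add_nonneg_pos)
  have c': "(\<lambda>k. c k * t ^ k) sums \<rho> (q + t *\<^sub>R u)" if "norm t < r'" for t
  proof (rule c)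
    have "\<bar>t\<bar> * norm u \<le> \<bar>t\<bar> * (norm u + 1)" by (intro mult_left_mono) auto
    also have "\<dots> < r"
      using that norm_ge_zero[of u] by (simp add: r'_def less_divide_eq add_nonneg_pos)
    finally show "norm (t *\<^sub>R u) < r" by simp
  qed
  have z0: "\<rho> (q + 0 *\<^sub>R u) = 0" using zero[of 0] \<open>d > 0\<close> by simp
  have cm: "c m = 0" if "m > 0" for m
  proof (rule ccontr)
    assume "c m \<noteq> 0"
    then obtain s where s: "0 < s" "\<And>t. t \<in> cball 0 s - {0} \<Longrightarrow> \<rho> (q + t *\<^sub>R u) \<noteq> 0"
      using powser_0_nonzero[where a=c and r=r' and \<xi>=0 and f="\<lambda>t. \<rho> (q + t *\<^sub>R u)" and m=m]
        r' c' z0 \<open>m > 0\<close> by auto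
    have "\<rho> (q + (- min s (d / 2)) *\<^sub>R u) \<noteq> 0" by (rule s(2)) (use s(1) \<open>d > 0\<close> in auto)
    moreover have "\<rho> (q + (- min s (d / 2)) *\<^sub>R u) = 0" by (rule zero) (use s(1) \<open>d > 0\<close> in auto)
    ultimately show False by blast
  qed
  have "\<rho> (q + t *\<^sub>R u) = 0" if "norm t < r'" for t
  proof -
    have "(\<lambda>k. c k * t ^ k) = (\<lambda>k. if k = 0 then c 0 else 0)" for t
      using cm by (auto simp: fun_eq_iff)
    then have "(\<lambda>k. if k = 0 then c 0 else 0) sums \<rho> (q + t *\<^sub>R u)"
      and "(\<lambda>k. if k = 0 then c 0 else 0) sums \<rho> (q + 0 *\<^sub>R u)"
      using c'[OF that] c'[of 0] r' by auto
    then show ?thesis using sums_unique2 z0 by metis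
  qed
  then show ?thesis
    unfolding eventually_at_right_field by (intro exI[of _ r']) (use r' in auto)
qed

definition strictly_convex :: "'a::euclidean_space set \<Rightarrow> bool" where
  "strictly_convex C \<longleftrightarrow> (\<forall>x\<in>closure C. \<forall>y\<in>closure C. x \<noteq> y \<longrightarrow> open_segment x y \<subseteq> C)"

text \<open>If some point of an open segment between closure points is not in \<open>C\<close>, the whole chord of the closure
on that line lies in the boundary. The chord is bounded, so it has a last point \<open>q\<close>; there the
defining function vanishes on one side along the line, hence on both, and the chord goes on.\<close>

lemma analytic_boundary_imp_strictly_convex:
  fixes C :: "(real ^ 'n) set"
  assumes C: "open C" "convex C" "bounded C" and an: "real_analytic_hypersurface (frontier C)"
  shows "strictly_convex C"
  unfolding strictly_convex_def
proof (intro ballI impI subsetI, rule ccontr)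
  fix x y z assume x: "x \<in> closure C" and y: "y \<in> closure C" and "x \<noteq> y"
    and "z \<in> open_segment x y" and z: "z \<notin> C"
  then obtain s where s: "0 < s" "s < 1" "z = (1 - s) *\<^sub>R x + s *\<^sub>R y"
    unfolding in_segment by blast
  define v where "v = y - x"
  have v: "v \<noteq> 0" "z = x + s *\<^sub>R v" using s \<open>x \<noteq> y\<close> by (auto simp: v_def algebra_simps)
  define L where "L = {t. x + t *\<^sub>R v \<in> closure C}"
  have "closed L"
    unfolding L_def by (rule closed_vimage[OF closed_closure, unfolded vimage_def]) (intro continuous_intros)
  moreover have "bounded L"
  proof -
    obtain B where B: "\<And>w. w \<in> closure C \<Longrightarrow> norm w \<le> B"
      using bounded_closure[OF C(3)] unfolding bounded_iff by blast
    have "norm t \<le> (B + norm x) / norm v" if "t \<in> L" for t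
    proof -
      have "norm (t *\<^sub>R v) \<le> norm (x + t *\<^sub>R v) + norm x"
        using norm_triangle_ineq4[of "x + t *\<^sub>R v" x] by simp
      also have "\<dots> \<le> B + norm x" using B that by (simp add: L_def)
      finally show ?thesis using v(1) by (simp add: le_divide_eq)
    qed
    then show ?thesis unfolding bounded_iff by blast
  qed
  ultimately have "compact L" by (simp add: compact_eq_bounded_closed)
  moreover have "1 \<in> L" using y by (simp add: L_def v_def)
  ultimately obtain b where b: "b \<in> L" "\<And>t. t \<in> L \<Longrightarrow> t \<le> b"
    using compact_attains_sup[of L] by blast
  have "1 \<le> b" using b(2) \<open>1 \<in> L\<close> by blast
  define q where "q = x + b *\<^sub>R v"
  have q: "q \<in> closure C" using b(1) by (simp add: L_def q_def)
  have int: "interior C = C" using C(1) by (rule interior_open)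
  have inseg: "p + u *\<^sub>R v \<in> open_segment (p + a *\<^sub>R v) (p + c *\<^sub>R v)" if "a < u" "u < c" for p and a u c :: real
  proof -
    have "p + u *\<^sub>R v = (1 - (u - a) / (c - a)) *\<^sub>R (p + a *\<^sub>R v) + ((u - a) / (c - a)) *\<^sub>R (p + c *\<^sub>R v)"
    proof -
      have "(1 - (u - a) / (c - a)) * a + ((u - a) / (c - a)) * c = a + (u - a) / (c - a) * (c - a)"
        by (simp only: left_diff_distrib right_diff_distrib)
      also have "\<dots> = u" using that by simp
      finally have "(1 - (u - a) / (c - a)) * a + ((u - a) / (c - a)) * c = u" .
      then have "u *\<^sub>R v = ((1 - (u - a) / (c - a)) * a) *\<^sub>R v + (((u - a) / (c - a)) * c) *\<^sub>R v"
        by (metis scaleR_add_left)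
      then show ?thesis by (simp add: scaleR_add_right scaleR_diff_left)
    qed
    moreover have "0 < (u - a) / (c - a)" "(u - a) / (c - a) < 1" using that by auto
    moreover have "p + a *\<^sub>R v \<noteq> p + c *\<^sub>R v" using that v(1) by auto
    ultimately show ?thesis unfolding in_segment by blast
  qed
  have fr: "x + t *\<^sub>R v \<in> frontier C" if t: "0 \<le> t" "t \<le> b" for t
  proof -
    have "x + t *\<^sub>R v = (1 - t / b) *\<^sub>R x + (t / b) *\<^sub>R q"
      using \<open>1 \<le> b\<close> by (simp add: q_def algebra_simps)
    moreover have "0 \<le> t / b" "t / b \<le> 1" using t \<open>1 \<le> b\<close> by auto
    ultimately have cl: "x + t *\<^sub>R v \<in> closure C"
      using convex_closure[OF C(2)] x q by (simp add: convex_def)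
    have "x + t *\<^sub>R v \<notin> C"
    proof
      assume tC: "x + t *\<^sub>R v \<in> C"
      then have "t \<noteq> s" using z v by auto
      then consider "t < s" | "s < t" by linarith
      then have "z \<in> C"
      proof cases
        case 1
        have "z \<in> open_segment (x + t *\<^sub>R v) (x + b *\<^sub>R v)"
          unfolding v(2) using 1 s \<open>1 \<le> b\<close> by (intro inseg) auto
        then show ?thesis
          using in_interior_closure_convex_segment[OF C(2), of "x + t *\<^sub>R v" q] tC q int by (auto simp: q_def)
      next
        case 2
        have "z \<in> open_segment (x + 0 *\<^sub>R v) (x + t *\<^sub>R v)"
          unfolding v(2) using 2 s by (intro inseg) auto
        then show ?thesis
          using in_interior_closure_convex_segment[OF C(2), of "x + t *\<^sub>R v" x] tC x int
          by (auto simp: open_segment_commute)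
      qed
      then show False using z by blast
    qed
    then show ?thesis using cl by (simp add: frontier_def int)
  qed
  have "q \<in> frontier C" unfolding q_def using fr \<open>1 \<le> b\<close> by simp
  then obtain U \<rho> where U: "open U" "q \<in> U" "real_analytic_on \<rho> U" "frontier C \<inter> U = {x \<in> U. \<rho> x = 0}"
    using an unfolding real_analytic_hypersurface_def by blast
  have "((\<lambda>t. q + t *\<^sub>R v) \<longlongrightarrow> q + 0 *\<^sub>R v) (at 0)" by (intro tendsto_intros)
  then have "\<forall>\<^sub>F t in at 0. q + t *\<^sub>R v \<in> U"
    using topological_tendstoD[OF _ U(1)] U(2) by simp
  then obtain d where d: "d > 0" "\<And>t. \<bar>t\<bar> < d \<Longrightarrow> t \<noteq> 0 \<Longrightarrow> q + t *\<^sub>R v \<in> U"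
    unfolding eventually_at by auto
  have dU: "q + t *\<^sub>R v \<in> U" if "\<bar>t\<bar> < d" for t
    using d(2)[OF that] U(2) by (cases "t = 0") auto
  have "\<rho> (q + t *\<^sub>R v) = 0" if "- min d b < t" "t \<le> 0" for t
  proof -
    have "q + t *\<^sub>R v = x + (b + t) *\<^sub>R v" by (simp add: q_def algebra_simps)
    then have "q + t *\<^sub>R v \<in> frontier C" using fr[of "b + t"] that by auto
    moreover have "q + t *\<^sub>R v \<in> U" by (rule dU) (use that in auto)
    ultimately show ?thesis using U(4) by blast
  qed
  then have "\<forall>\<^sub>F t in at_right 0. \<rho> (q + t *\<^sub>R v) = 0"
    using d(1) \<open>1 \<le> b\<close> by (intro real_analytic_zero_extends[OF U(3,2), of "min d b"]) auto
  moreover have "\<forall>\<^sub>F t in at_right 0. t < d" using d(1) by (auto simp: eventually_at_right_field)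
  moreover have "\<forall>\<^sub>F t::real in at_right 0. 0 < t" by (rule eventually_at_right_less)
  ultimately have "\<forall>\<^sub>F t in at_right 0. \<rho> (q + t *\<^sub>R v) = 0 \<and> t < d \<and> 0 < t"
    by eventually_elim auto
  then obtain t where t: "\<rho> (q + t *\<^sub>R v) = 0" "t < d" "0 < t"
    using eventually_happens by fastforce
  then have "q + t *\<^sub>R v \<in> frontier C" using U(4) dU[of t] by auto
  then have "b + t \<in> L" by (simp add: L_def q_def frontier_def algebra_simps)
  then show False using b(2)[of "b + t"] t(3) by simp
qed

section \<open>Chords between opposite supporting hyperplanes\<close>

lemma linear_functional_strict_on_open:
  fixes C :: "'a::euclidean_space set"
  assumes "open C" "n \<noteq> 0" "\<And>x. x \<in> C \<Longrightarrow> n \<bullet> x \<le> m" "x \<in> C"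
  shows "n \<bullet> x < m"
proof -
  have "((\<lambda>t. x + t *\<^sub>R n) \<longlongrightarrow> x + 0 *\<^sub>R n) (at_right 0)"
    by (intro tendsto_intros)
  then have "\<forall>\<^sub>F t in at_right 0. x + t *\<^sub>R n \<in> C"
    using topological_tendstoD[OF _ assms(1)] assms(4) by simp
  then have "\<forall>\<^sub>F t in at_right (0::real). x + t *\<^sub>R n \<in> C \<and> t > 0"
    using eventually_at_right_less eventually_conj by blast
  then obtain t where t: "x + t *\<^sub>R n \<in> C" "t > 0"
    using eventually_happens by fastforce
  have "n \<bullet> x < n \<bullet> x + t * (n \<bullet> n)" using t(2) assms(2) by simp
  also have "\<dots> = n \<bullet> (x + t *\<^sub>R n)" by (simp add: inner_add_right)
  also have "\<dots> \<le> m" by (rule assms(3)[OF t(1)])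
  finally show ?thesis .
qed

text \<open>Take a chord of maximal length in the direction \<open>u\<close>. By maximality the translate of \<open>C\<close> along this
chord is disjoint from \<open>C\<close>, and a hyperplane separating the two sets supports \<open>C\<close> at one end of the
chord and, translated back, at the other end.\<close>

lemma longest_chord:
  fixes C :: "'a::euclidean_space set"
  assumes C: "open C" "convex C" "bounded C" "C \<noteq> {}" and "u \<noteq> 0"
  obtains n a s where "n \<noteq> 0" "a \<in> closure C" "a + s *\<^sub>R u \<in> closure C"
    and "\<And>x. x \<in> closure C \<Longrightarrow> n \<bullet> a \<le> n \<bullet> x \<and> n \<bullet> x \<le> n \<bullet> (a + s *\<^sub>R u)"
proof -
  define P where "P = {(x, s). x \<in> closure C \<and> x + s *\<^sub>R u \<in> closure C}"
  have "closed P"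
  proof -
    have "P = {p. fst p \<in> closure C} \<inter> {p. fst p + snd p *\<^sub>R u \<in> closure C}"
      by (auto simp: P_def)
    moreover have "closed {p :: 'a \<times> real. fst p \<in> closure C}"
      by (rule closed_vimage[OF closed_closure, unfolded vimage_def]) (intro continuous_intros)
    moreover have "closed {p. fst p + snd p *\<^sub>R u \<in> closure C}"
      by (rule closed_vimage[OF closed_closure, unfolded vimage_def]) (intro continuous_intros)
    ultimately show ?thesis by auto
  qed
  moreover have "bounded P"
  proof -
    obtain B where B: "\<And>w. w \<in> closure C \<Longrightarrow> norm w \<le> B"
      using bounded_closure[OF C(3)] unfolding bounded_iff by blast
    have "P \<subseteq> cball 0 B \<times> cball 0 (2 * B / norm u)"
    proof safe
      fix x s assume p: "(x, s) \<in> P"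
      then show "x \<in> cball 0 B" using B by (simp add: P_def)
      have "norm (s *\<^sub>R u) \<le> norm (x + s *\<^sub>R u) + norm x"
        using norm_triangle_ineq4[of "x + s *\<^sub>R u" x] by simp
      also have "\<dots> \<le> B + B" using B p by (intro add_mono) (auto simp: P_def)
      finally show "s \<in> cball 0 (2 * B / norm u)" using \<open>u \<noteq> 0\<close> by (simp add: le_divide_eq)
    qed
    then show ?thesis using bounded_subset bounded_Times bounded_cball by metis
  qed
  ultimately have cP: "compact P" by (simp add: compact_eq_bounded_closed)
  obtain x0 where "x0 \<in> C" using C(4) by blast
  then have "(x0, 0) \<in> P" using closure_subset by (auto simp: P_def)
  then have "P \<noteq> {}" by blast
  moreover have "continuous_on P snd" by (intro continuous_intros)
  ultimately obtain p where p: "p \<in> P" "\<And>p'. p' \<in> P \<Longrightarrow> snd p' \<le> snd p"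
    using continuous_attains_sup[OF cP] by metis
  obtain a s where as: "p = (a, s)" by (cases p)
  have a: "a \<in> closure C" "a + s *\<^sub>R u \<in> closure C" using p(1) by (auto simp: P_def as)
  have max: "s' \<le> s" if "x \<in> closure C" "x + s' *\<^sub>R u \<in> closure C" for x s'
    using p(2)[of "(x, s')"] that by (simp add: P_def as)
  have disj: "C \<inter> (\<lambda>x. x + s *\<^sub>R u) ` C = {}"
  proof (rule ccontr)
    assume "C \<inter> (\<lambda>x. x + s *\<^sub>R u) ` C \<noteq> {}"
    then obtain x where x: "x \<in> C" "x + s *\<^sub>R u \<in> C" by blast
    have "((\<lambda>t. x + t *\<^sub>R u) \<longlongrightarrow> x + s *\<^sub>R u) (at_right s)"
      by (intro tendsto_intros)
    then have "\<forall>\<^sub>F t in at_right s. x + t *\<^sub>R u \<in> C"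
      using topological_tendstoD[OF _ C(1)] x(2) by blast
    then have "\<forall>\<^sub>F t in at_right s. x + t *\<^sub>R u \<in> C \<and> t > s"
      using eventually_at_right_less eventually_conj by blast
    then obtain t where "x + t *\<^sub>R u \<in> C" "t > s"
      using eventually_happens by fastforce
    then show False using max[of x t] x(1) closure_subset by force
  qed
  moreover have "convex ((\<lambda>x. x + s *\<^sub>R u) ` C)"
    using convex_translation[OF C(2), of "s *\<^sub>R u"] by (simp add: add.commute)
  moreover have "(\<lambda>x. x + s *\<^sub>R u) ` C \<noteq> {}" using C(4) by simp
  ultimately obtain n m where nm: "n \<noteq> 0" "\<forall>x\<in>C. n \<bullet> x \<le> m"
      "\<forall>x\<in>(\<lambda>x. x + s *\<^sub>R u) ` C. m \<le> n \<bullet> x"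
    using separating_hyperplane_sets[OF C(2) _ C(4)] by metis
  then have n: "n \<noteq> 0" "\<And>x. x \<in> C \<Longrightarrow> n \<bullet> x \<le> m" "\<And>x. x \<in> C \<Longrightarrow> m \<le> n \<bullet> (x + s *\<^sub>R u)"
    by auto
  have cl1: "n \<bullet> x \<le> m" if "x \<in> closure C" for x
  proof -
    have "closure C \<subseteq> {x. n \<bullet> x \<le> m}"
      by (rule closure_minimal) (use n(2) closed_halfspace_le in auto)
    then show ?thesis using that by blast
  qed
  have cl2: "m - n \<bullet> (s *\<^sub>R u) \<le> n \<bullet> x" if "x \<in> closure C" for x
  proof -
    have "closure C \<subseteq> {x. m - n \<bullet> (s *\<^sub>R u) \<le> n \<bullet> x}"
    proof (rule closure_minimal)
      show "C \<subseteq> {x. m - n \<bullet> (s *\<^sub>R u) \<le> n \<bullet> x}"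
        using n(3) by (auto simp: inner_add_right algebra_simps)
    qed (rule closed_halfspace_ge)
    then show ?thesis using that by blast
  qed
  have "n \<bullet> a = m - n \<bullet> (s *\<^sub>R u)" "n \<bullet> (a + s *\<^sub>R u) = m"
    using cl1[OF a(2)] cl2[OF a(1)] by (auto simp: inner_add_right)
  then have "\<And>x. x \<in> closure C \<Longrightarrow> n \<bullet> a \<le> n \<bullet> x \<and> n \<bullet> x \<le> n \<bullet> (a + s *\<^sub>R u)"
    using cl1 cl2 by auto
  then show ?thesis using that n(1) a by blast
qed

lemma strictly_convex_unique_maximizer:
  assumes "open C" "strictly_convex C" "n \<noteq> 0" "p \<in> closure C"
    and max: "\<And>y. y \<in> closure C \<Longrightarrow> n \<bullet> y \<le> n \<bullet> p" and y: "y \<in> closure C" "y \<noteq> p"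
  shows "n \<bullet> y < n \<bullet> p"
proof -
  have "midpoint y p \<in> open_segment y p" using y by simp
  then have "midpoint y p \<in> C" using assms(2,4) y unfolding strictly_convex_def by blast
  then have "n \<bullet> midpoint y p < n \<bullet> p"
    by (intro linear_functional_strict_on_open[OF assms(1,3)] max) (use closure_subset in auto)
  then show ?thesis by (simp add: midpoint_def inner_add_right)
qed

text \<open>Outside a ball around the unique maximiser \<open>p\<close> the functional stays below its maximum by a fixed
amount, which a small perturbation of \<open>n\<close> cannot make up.\<close>

lemma maximizer_stable:
  fixes K :: "'a::euclidean_space set"
  assumes K: "compact K" and p: "p \<in> K" "\<And>y. y \<in> K \<Longrightarrow> y \<noteq> p \<Longrightarrow> n \<bullet> y < n \<bullet> p" and "e > 0"
  obtains d where "d > 0"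
    "\<And>n' p'. norm (n' - n) < d \<Longrightarrow> p' \<in> K \<Longrightarrow> (\<And>y. y \<in> K \<Longrightarrow> n' \<bullet> y \<le> n' \<bullet> p') \<Longrightarrow> norm (p' - p) < e"
proof (cases "K - ball p e = {}")
  case True
  then have "norm (p' - p) < e" if "p' \<in> K" for p' using that by (auto simp: dist_norm norm_minus_commute)
  then show ?thesis using that[of 1] by auto
next
  case False
  have "compact (K - ball p e)" using K by (intro compact_diff) auto
  moreover have "continuous_on (K - ball p e) (\<lambda>y. n \<bullet> (p - y))" by (intro continuous_intros)
  ultimately obtain y0 where y0: "y0 \<in> K - ball p e" "\<And>y. y \<in> K - ball p e \<Longrightarrow> n \<bullet> (p - y0) \<le> n \<bullet> (p - y)"
    using continuous_attains_inf[of "K - ball p e"] False by metis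
  define \<mu> where "\<mu> = n \<bullet> (p - y0)"
  have "y0 \<noteq> p" using y0(1) \<open>e > 0\<close> by auto
  then have \<mu>: "\<mu> > 0" using p(2)[of y0] y0(1) by (simp add: \<mu>_def inner_diff_right)
  obtain B where B: "B > 0" "\<And>x. x \<in> K \<Longrightarrow> norm x \<le> B"
    using compact_imp_bounded[OF K] unfolding bounded_pos by blast
  show ?thesis
  proof (rule that)
    show "\<mu> / (2 * B) > 0" using \<mu> B by simp
    fix n' p' assume n': "norm (n' - n) < \<mu> / (2 * B)" and p': "p' \<in> K" "\<And>y. y \<in> K \<Longrightarrow> n' \<bullet> y \<le> n' \<bullet> p'"
    show "norm (p' - p) < e"
    proof (rule ccontr)
      assume "\<not> norm (p' - p) < e"
      then have "p' \<in> K - ball p e" using p'(1) by (simp add: dist_norm norm_minus_commute)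
      then have 1: "\<mu> \<le> n \<bullet> (p - p')" unfolding \<mu>_def by (rule y0(2))
      have "norm (p - p') \<le> 2 * B"
        using norm_triangle_ineq4[of p p'] B(2)[OF p(1)] B(2)[OF p'(1)] by linarith
      then have "norm (n' - n) * norm (p - p') \<le> norm (n' - n) * (2 * B)" by (intro mult_left_mono) auto
      also have "\<dots> < \<mu>" using n' B(1) by (simp add: less_divide_eq)
      finally have "\<bar>(n' - n) \<bullet> (p - p')\<bar> < \<mu>"
        using Cauchy_Schwarz_ineq2[of "n' - n" "p - p'"] by linarith
      moreover have "n' \<bullet> (p - p') \<le> 0" using p'(2)[OF p(1)] by (simp add: inner_diff_right)
      ultimately show False using 1 by (simp add: inner_diff_left)
    qed
  qed
qed

text \<open>The chord from \<open>a\<close> to \<open>a + v\<close> joins points of the two supporting hyperplanes with normal \<open>n\<close> and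
otherwise runs inside \<open>C\<close>. Then \<open>\<zeta> \<mapsto> a + \<zeta> v\<close> maps the unit strip into the tube, and \<open>n\<close>, suitably
normalised, maps the tube back to the unit strip and inverts it.\<close>

definition supporting_chord :: "(real ^ 'n) set \<Rightarrow> real ^ 'n \<Rightarrow> real ^ 'n \<Rightarrow> real ^ 'n \<Rightarrow> bool" where
  "supporting_chord C n a v \<longleftrightarrow> (\<forall>x\<in>C. n \<bullet> a < n \<bullet> x \<and> n \<bullet> x < n \<bullet> (a + v)) \<and>
     (\<forall>s. 0 < s \<longrightarrow> s < 1 \<longrightarrow> a + s *\<^sub>R v \<in> C)"

text \<open>Starting from a longest chord among those parallel to some \<open>u\<close> orthogonal to \<open>l\<close>, which exists because
the dimension is at least 2, one may vary the normal: strict convexity makes the end points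
of the chord continuous in it.\<close>

lemma supporting_chords_nearly_orthogonal:
  fixes C :: "(real ^ 'n) set"
  assumes dim: "CARD('n) \<ge> 2"
    and C: "open C" "convex C" "bounded C" "C \<noteq> {}" and sc: "strictly_convex C" and "c > 0"
  obtains n \<tau> where "\<tau> > 0"
    "\<And>n'. norm (n' - n) < \<tau> \<Longrightarrow> \<exists>a v. supporting_chord C n' a v \<and> \<bar>l \<bullet> v\<bar> < c"
proof -
  obtain u where u: "u \<noteq> 0" "orthogonal l u"
    using orthogonal_to_vector_exists[of l] dim by auto
  obtain n a s where n: "n \<noteq> 0" "a \<in> closure C" "a + s *\<^sub>R u \<in> closure C"
    "\<And>x. x \<in> closure C \<Longrightarrow> n \<bullet> a \<le> n \<bullet> x \<and> n \<bullet> x \<le> n \<bullet> (a + s *\<^sub>R u)"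
    using longest_chord[OF C u(1)] by metis
  have K: "compact (closure C)" using C(3) by (simp add: compact_closure)
  define b where "b = a + s *\<^sub>R u"
  have lb: "l \<bullet> (b - a) = 0" using u(2) by (simp add: b_def orthogonal_def)
  define e where "e = c / (2 * (norm l + 1))"
  have e: "e > 0" using \<open>c > 0\<close> by (simp add: e_def add_nonneg_pos)
  have umax: "n \<bullet> y < n \<bullet> b" if "y \<in> closure C" "y \<noteq> b" for y
    by (rule strictly_convex_unique_maximizer[OF C(1) sc n(1) _ _ that]) (use n b_def in auto)
  have umin: "- n \<bullet> y < - n \<bullet> a" if "y \<in> closure C" "y \<noteq> a" for y
    by (rule strictly_convex_unique_maximizer[OF C(1) sc _ _ _ that]) (use n in auto)
  obtain d1 where d1: "d1 > 0" "\<And>n' p'. norm (n' - n) < d1 \<Longrightarrow> p' \<in> closure C \<Longrightarrow>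
      (\<And>y. y \<in> closure C \<Longrightarrow> n' \<bullet> y \<le> n' \<bullet> p') \<Longrightarrow> norm (p' - b) < e"
    using maximizer_stable[OF K _ umax e] n(3) unfolding b_def by blast
  obtain d2 where d2: "d2 > 0" "\<And>n' p'. norm (n' - (- n)) < d2 \<Longrightarrow> p' \<in> closure C \<Longrightarrow>
      (\<And>y. y \<in> closure C \<Longrightarrow> n' \<bullet> y \<le> n' \<bullet> p') \<Longrightarrow> norm (p' - a) < e"
    using maximizer_stable[OF K n(2) umin e] by blast
  show ?thesis
  proof (rule that)
    show "min (min d1 d2) (norm n) > 0" using d1(1) d2(1) n(1) by simp
    fix n' assume n': "norm (n' - n) < min (min d1 d2) (norm n)"
    then have nz: "n' \<noteq> 0" by auto
    have ne: "closure C \<noteq> {}" using C(4) by simp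
    have cont: "continuous_on (closure C) (\<lambda>y. n' \<bullet> y)" by (intro continuous_intros)
    obtain p where p: "p \<in> closure C" "\<And>y. y \<in> closure C \<Longrightarrow> n' \<bullet> y \<le> n' \<bullet> p"
      using continuous_attains_sup[OF K ne cont] by blast
    obtain q where q: "q \<in> closure C" "\<And>y. y \<in> closure C \<Longrightarrow> n' \<bullet> q \<le> n' \<bullet> y"
      using continuous_attains_inf[OF K ne cont] by blast
    have "norm (p - b) < e" by (rule d1(2)[OF _ p]) (use n' in auto)
    moreover have "norm (q - a) < e"
    proof (rule d2(2)[of "- n'"])
      show "norm (- n' - - n) < d2" using n' by (simp add: norm_minus_commute)
    qed (use q in auto)
    ultimately have "norm ((p - b) - (q - a)) < 2 * e"
      using norm_triangle_ineq4[of "p - b" "q - a"] by linarith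
    then have "norm l * norm ((p - b) - (q - a)) \<le> norm l * (2 * e)" by (intro mult_left_mono) auto
    also have "\<dots> < c"
    proof -
      have "norm l * (2 * e) < (norm l + 1) * (2 * e)" using e by (intro mult_strict_right_mono) auto
      also have "\<dots> = c" using norm_ge_zero[of l] unfolding e_def by (simp add: field_simps add_nonneg_eq_0_iff)
      finally show ?thesis .
    qed
    finally have "\<bar>l \<bullet> ((p - b) - (q - a))\<bar> < c"
      using Cauchy_Schwarz_ineq2[of l "(p - b) - (q - a)"] by linarith
    then have lv: "\<bar>l \<bullet> (p - q)\<bar> < c" using lb by (simp add: inner_diff_right)
    have strict: "n' \<bullet> q < n' \<bullet> x" "n' \<bullet> x < n' \<bullet> p" if "x \<in> C" for x
    proof -
      show "n' \<bullet> x < n' \<bullet> p"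
        by (rule linear_functional_strict_on_open[OF C(1) nz _ that]) (use p closure_subset in auto)
      have "- n' \<bullet> x < - n' \<bullet> q"
        by (rule linear_functional_strict_on_open[OF C(1) _ _ that]) (use nz q closure_subset in auto)
      then show "n' \<bullet> q < n' \<bullet> x" by simp
    qed
    have "q \<noteq> p" using strict C(4) by force
    have "q + t *\<^sub>R (p - q) \<in> C" if "0 < t" "t < 1" for t
    proof -
      have "q + t *\<^sub>R (p - q) = (1 - t) *\<^sub>R q + t *\<^sub>R p" by (simp add: algebra_simps)
      then have "q + t *\<^sub>R (p - q) \<in> open_segment q p"
        using that \<open>q \<noteq> p\<close> unfolding in_segment by blast
      then show ?thesis using sc q(1) p(1) \<open>q \<noteq> p\<close> unfolding strictly_convex_def by blast
    qed
    then have "supporting_chord C n' q (p - q)"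
      using strict by (simp add: supporting_chord_def)
    then show "\<exists>a v. supporting_chord C n' a v \<and> \<bar>l \<bullet> v\<bar> < c" using lv by blast
  qed
qed

section \<open>Convex sets, compactness and exponential growth\<close>

lemma ball_convex_combination:
  fixes C :: "'a::real_normed_vector set"
  assumes "convex C" "ball x r \<subseteq> C" "ball y r \<subseteq> C" "0 \<le> t" "t \<le> 1"
  shows "ball (x + t *\<^sub>R (y - x)) r \<subseteq> C"
proof
  fix q assume q: "q \<in> ball (x + t *\<^sub>R (y - x)) r"
  define d where "d = q - (x + t *\<^sub>R (y - x))"
  have "norm d < r" using q by (simp add: d_def dist_norm norm_minus_commute)
  then have "x + d \<in> C" "y + d \<in> C" using assms(2,3) by (auto simp: dist_norm)
  then have "(1 - t) *\<^sub>R (x + d) + t *\<^sub>R (y + d) \<in> C"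
    using assms(1,4,5) by (simp add: convex_def)
  moreover have "(1 - t) *\<^sub>R (x + d) + t *\<^sub>R (y + d) = q"
    by (simp add: d_def algebra_simps)
  ultimately show "q \<in> C" by simp
qed

lemma compact_uniform_ball:
  fixes C :: "'a::euclidean_space set"
  assumes "compact X" "X \<subseteq> C" "open C"
  obtains r where "0 < r" "\<And>x. x \<in> X \<Longrightarrow> ball x r \<subseteq> C"
proof -
  obtain e where e: "e > 0" "(\<Union>x\<in>X. cball x e) \<subseteq> C"
    using compact_subset_open_imp_cball_epsilon_subset[OF assms(1,3,2)] by metis
  then have "ball x e \<subseteq> C" if "x \<in> X" for x using that ball_subset_cball by blast
  then show ?thesis using that e(1) by blast
qed

text \<open>Let \<open>p\<close> almost maximise \<open>U x exp(-\<epsilon> |x|\<^sup>2)\<close>. Comparing \<open>p + x\<close> with \<open>p\<close> and expanding the square gives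
the bound with \<open>l = 2 \<epsilon> p\<close>. The a priori growth of \<open>U\<close> forces \<open>|p| = O(1/\<epsilon>)\<close>, so \<open>l\<close> stays bounded
and converges along a subsequence of \<open>\<epsilon> = 1, 1/2, 1/3, ...\<close>.\<close>

lemma exponential_tilt:
  fixes U :: "'a::euclidean_space \<Rightarrow> real"
  assumes pos: "\<And>x. 0 < U x" and growth: "\<And>x. U x \<le> U 0 * exp (b * norm x + 1)" and "0 \<le> b"
  obtains p l l0 \<epsilon> where "l \<longlonglongrightarrow> l0" and "\<epsilon> \<longlonglongrightarrow> 0"
    and "\<And>j x. U (p j + x) \<le> 2 * U (p j) * exp (l j \<bullet> x + \<epsilon> j * (norm x)\<^sup>2)"
proof -
  define \<delta> where "\<delta> j = inverse (real (Suc j))" for j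
  have \<delta>: "0 < \<delta> j" "\<delta> j \<le> 1" for j by (auto simp: \<delta>_def field_simps)
  have "\<exists>y. \<forall>x. U x * exp (- \<delta> j * (norm x)\<^sup>2) \<le> 2 * (U y * exp (- \<delta> j * (norm y)\<^sup>2))" for j
  proof -
    define V where "V x = U x * exp (- \<delta> j * (norm x)\<^sup>2)" for x
    have "V x \<le> U 0 * exp (b\<^sup>2 / (4 * \<delta> j) + 1)" for x
    proof -
      \<comment> \<open>The maximum of the quadratic on the left, by completing the square.\<close>
    have "b * norm x - \<delta> j * (norm x)\<^sup>2 \<le> b\<^sup>2 / (4 * \<delta> j)"
      proof -
        have "0 \<le> (2 * \<delta> j * norm x - b)\<^sup>2" by simp
        then have "4 * \<delta> j * (b * norm x - \<delta> j * (norm x)\<^sup>2) \<le> b\<^sup>2"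
          by (simp add: power2_eq_square algebra_simps)
        then show ?thesis using \<delta>(1)[of j] by (simp add: le_divide_eq mult_ac)
      qed
      have "V x \<le> U 0 * exp (b * norm x + 1) * exp (- \<delta> j * (norm x)\<^sup>2)"
        unfolding V_def by (intro mult_right_mono growth) auto
      also have "\<dots> = U 0 * exp ((b * norm x - \<delta> j * (norm x)\<^sup>2) + 1)"
        by (simp add: exp_add[symmetric] algebra_simps)
      also have "\<dots> \<le> U 0 * exp (b\<^sup>2 / (4 * \<delta> j) + 1)"
        using pos[of 0] \<open>b * norm x - \<delta> j * (norm x)\<^sup>2 \<le> _\<close> by (intro mult_left_mono) auto
      finally show ?thesis .
    qed
    then have bdd: "bdd_above (range V)" by (auto simp: bdd_above_def)
    have "0 < V 0" using pos by (simp add: V_def)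
    also have "V 0 \<le> Sup (range V)" by (rule cSUP_upper[OF _ bdd]) simp
    finally have "Sup (range V) / 2 < Sup (range V)" by simp
    then obtain y where "Sup (range V) / 2 < V y"
      using less_cSUP_iff[OF UNIV_not_empty bdd] by blast
    moreover have "V x \<le> Sup (range V)" for x by (rule cSUP_upper[OF _ bdd]) simp
    ultimately have "V x \<le> 2 * V y" for x by (smt (verit) field_sum_of_halves)
    then show ?thesis unfolding V_def by blast
  qed
  then obtain p where p: "\<And>j x. U x * exp (- \<delta> j * (norm x)\<^sup>2) \<le> 2 * (U (p j) * exp (- \<delta> j * (norm (p j))\<^sup>2))"
    by metis
  define l where "l j = (2 * \<delta> j) *\<^sub>R p j" for j
  have tilt: "U (p j + x) \<le> 2 * U (p j) * exp (l j \<bullet> x + \<delta> j * (norm x)\<^sup>2)" for j x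
  proof -
    have n: "(norm (p j + x))\<^sup>2 = (norm (p j))\<^sup>2 + 2 * (p j \<bullet> x) + (norm x)\<^sup>2"
      by (simp add: power2_norm_eq_inner inner_add_left inner_add_right inner_commute)
    have "U (p j + x) = (U (p j + x) * exp (- \<delta> j * (norm (p j + x))\<^sup>2)) * exp (\<delta> j * (norm (p j + x))\<^sup>2)"
      by (simp add: mult.assoc exp_add[symmetric])
    also have "\<dots> \<le> (2 * (U (p j) * exp (- \<delta> j * (norm (p j))\<^sup>2))) * exp (\<delta> j * (norm (p j + x))\<^sup>2)"
      by (intro mult_right_mono p) auto
    also have "\<dots> = 2 * U (p j) * (exp (- \<delta> j * (norm (p j))\<^sup>2 + \<delta> j * (norm (p j + x))\<^sup>2))"
      by (simp only: exp_add mult.assoc)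
    also have "- \<delta> j * (norm (p j))\<^sup>2 + \<delta> j * (norm (p j + x))\<^sup>2 = l j \<bullet> x + \<delta> j * (norm x)\<^sup>2"
      unfolding n by (simp add: l_def algebra_simps)
    finally show ?thesis .
  qed
  have lb: "norm (l j) \<le> 2 * (b + 2)" for j
  proof -
    define t where "t = norm (p j)"
    have "U 0 \<le> 2 * (U (p j) * exp (- \<delta> j * t\<^sup>2))" using p[of 0 j] by (simp add: t_def)
    also have "\<dots> \<le> exp 1 * ((U 0 * exp (b * t + 1)) * exp (- \<delta> j * t\<^sup>2))"
      using growth[of "p j"] exp_ge_add_one_self[of 1] pos[of "p j"] unfolding t_def
      by (intro mult_mono) (auto simp: less_imp_le)
    also have "\<dots> = U 0 * exp (1 + (b * t + 1) + - \<delta> j * t\<^sup>2)"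
      unfolding exp_add by (simp only: mult_ac)
    finally have "1 \<le> exp (1 + (b * t + 1) + - \<delta> j * t\<^sup>2)" using pos[of 0] by simp
    then have 1: "\<delta> j * t\<^sup>2 \<le> b * t + 2" by simp
    have "\<delta> j * t \<le> b + 2"
    proof (cases "1 \<le> t")
      case True
      then have "b * t + 2 \<le> (b + 2) * t" by (simp add: algebra_simps)
      with 1 have "(\<delta> j * t) * t \<le> (b + 2) * t" by (simp add: power2_eq_square mult.assoc)
      then show ?thesis using True by simp
    next
      case False
      have "\<delta> j * t \<le> 1 * 1" using False \<delta>[of j] by (intro mult_mono) (auto simp: t_def)
      then show ?thesis using \<open>0 \<le> b\<close> by simp
    qed
    then show ?thesis using \<delta>[of j] by (simp add: l_def t_def)
  qed
  have "seq_compact (cball (0::'a) (2 * (b + 2)))" by (simp add: compact_imp_seq_compact)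
  moreover have "\<forall>j. l j \<in> cball 0 (2 * (b + 2))" using lb by simp
  ultimately obtain l0 and \<sigma> :: "nat \<Rightarrow> nat" where \<sigma>: "strict_mono \<sigma>" "(l \<circ> \<sigma>) \<longlonglongrightarrow> l0"
    unfolding seq_compact_def by blast
  have "(\<delta> \<circ> \<sigma>) \<longlonglongrightarrow> 0"
    unfolding \<delta>_def[abs_def] by (rule LIMSEQ_subseq_LIMSEQ[OF LIMSEQ_inverse_real_of_nat \<sigma>(1)])
  then show ?thesis using that[OF \<sigma>(2), of "\<delta> \<circ> \<sigma>" "p \<circ> \<sigma>"] tilt by simp
qed

section \<open>Distance to the boundary of a bounded convex model\<close>

locale tube_onto_convex =
  fixes C :: "(real ^ 'n) set" and D :: "(complex ^ 'n) set"
    and F H :: "complex ^ 'n \<Rightarrow> complex ^ 'n"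
  assumes C: "open C" "convex C" "bounded C" "C \<noteq> {}"
    and D: "open D" "convex D" "bounded D"
    and F: "holomorphic_map_on F (tube C)" "\<And>z. z \<in> tube C \<Longrightarrow> F z \<in> D"
    and H: "holomorphic_map_on H D" "\<And>w. w \<in> D \<Longrightarrow> H w \<in> tube C"
    and HF: "\<And>z. z \<in> tube C \<Longrightarrow> H (F z) = z"
    and FH: "\<And>w. w \<in> D \<Longrightarrow> F (H w) = w"
begin

text \<open>For points of \<open>D\<close> this is the distance to the boundary; using the complement makes it the radius of
the largest ball around \<open>w\<close> inside \<open>D\<close>.\<close>

definition depth :: "complex ^ 'n \<Rightarrow> real" where
  "depth w = infdist w (- D)"

lemma compl_D: "- D \<noteq> {}" "closed (- D)"
proof -
  have "D \<noteq> UNIV" using D(3) not_bounded_UNIV by auto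
  then show "- D \<noteq> {}" by auto
  show "closed (- D)" using D(1) by (simp add: closed_def)
qed

lemma ball_depth: "ball w (depth w) \<subseteq> D"
  using infdist_le[of _ "- D" w] by (force simp: depth_def)

lemma depth_pos: "w \<in> D \<Longrightarrow> 0 < depth w"
  using in_closed_iff_infdist_zero[OF compl_D(2,1), of w] infdist_nonneg[of w "- D"]
  by (auto simp: depth_def order_less_le)

lemma le_depth: "ball w s \<subseteq> D \<Longrightarrow> s \<le> depth w"
  unfolding depth_def infdist_notempty[OF compl_D(1)]
  by (rule cINF_greatest) (use compl_D in \<open>force simp: not_less\<close>)+

text \<open>For every affine function positive on \<open>D\<close>, Harnack's inequality at a third of the radius gives at
\<open>F z'\<close> at least half of its value at \<open>F z\<close>. Hence \<open>2 F z' - F z\<close> lies in the closure of \<open>D\<close>, that is,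
\<open>F z'\<close> is the midpoint of \<open>F z\<close> and a point of the closure, and by convexity a ball around \<open>F z\<close> in \<open>D\<close>
yields one of half the radius around \<open>F z'\<close>.\<close>

lemma depth_harnack_step:
  assumes r: "0 < r" "ball z r \<subseteq> tube C" and z': "norm (z' - z) \<le> r / 3"
  shows "depth (F z) / 2 \<le> depth (F z')"
proof -
  define u where "u = z' - z"
  define c where "c \<zeta> = z + \<zeta> *s u" for \<zeta>
  have zt: "z \<in> tube C" and z't: "z' \<in> tube C"
    using r z' by (auto simp: dist_norm norm_minus_commute)
  have ct: "c \<zeta> \<in> tube C" if "\<zeta> \<in> ball 0 3" for \<zeta>
  proof -
    have "norm (\<zeta> *s u) \<le> norm \<zeta> * (r / 3)"
      unfolding norm_cscale u_def using z' by (intro mult_left_mono) auto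
    also have "\<dots> < r" using that \<open>0 < r\<close> by simp
    finally show ?thesis using r(2) by (auto simp: c_def dist_norm)
  qed
  have cd: "\<exists>u. curve_deriv (\<lambda>\<zeta>. F (c \<zeta>)) u \<zeta>" if "\<zeta> \<in> ball 0 3" for \<zeta>
    using curve_deriv_compose[where c=c, OF F(1) ct[OF that] curve_deriv_affine[of z u \<zeta>, folded c_def]]
    by blast
  define w'' where "w'' = 2 *\<^sub>R F z' - F z"
  have w'': "w'' \<in> closure D"
  proof (rule ccontr)
    assume "w'' \<notin> closure D"
    then obtain a b where ab: "a \<bullet> w'' < b" "\<And>x. x \<in> closure D \<Longrightarrow> b < a \<bullet> x"
      using separating_hyperplane_closed_point[of "closure D" w''] D(2) by auto
    define h where "h \<zeta> = (\<Sum>i\<in>UNIV. cnj (a $ i) * F (c \<zeta>) $ i) - of_real b" for \<zeta>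
    have Re: "Re (h \<zeta>) = a \<bullet> F (c \<zeta>) - b" for \<zeta>
      by (simp add: h_def inner_eq_Re)
    have "h holomorphic_on ball 0 3"
      unfolding h_def by (intro holomorphic_intros holomorphic_on_curve(2) cd) auto
    moreover have "Re (h \<zeta>) > 0" if "\<zeta> \<in> ball 0 3" for \<zeta>
      unfolding Re using ab(2) F(2)[OF ct[OF that]] closure_subset by force
    ultimately have "Re (h 0) / 2 \<le> Re (h 1)"
      by (intro schwarz_right_half_plane(2)[where r=3]) auto
    then have "b \<le> a \<bullet> w''"
      by (simp add: Re c_def u_def w''_def inner_diff_right)
    with ab(1) show False by simp
  qed
  have "ball (F z') (depth (F z) / 2) \<subseteq> D"
  proof
    fix y assume y: "y \<in> ball (F z') (depth (F z) / 2)"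
    define x where "x = F z + 2 *\<^sub>R (y - F z')"
    have "dist (F z) x < depth (F z)" using y by (simp add: x_def dist_norm norm_minus_commute)
    then have "x \<in> interior D" using ball_depth[of "F z"] D(1) by (auto simp: interior_open)
    then have "w'' - (1/2) *\<^sub>R (w'' - x) \<in> interior D"
      by (intro mem_interior_closure_convex_shrink D w'') auto
    moreover have "w'' - (1/2) *\<^sub>R (w'' - x) = (1/2) *\<^sub>R (w'' + x)"
      by (simp add: vec_eq_iff complex_eq_iff field_simps)
    moreover have "w'' + x = 2 *\<^sub>R y" by (simp add: w''_def x_def algebra_simps)
    ultimately show "y \<in> D" using interior_subset by auto
  qed
  then show ?thesis by (rule le_depth)
qed

text \<open>A chain of \<open>N\<close> steps along the segment from \<open>z\<close> to \<open>z'\<close>, whose points all keep distance \<open>r\<close> from the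
boundary by convexity of \<open>C\<close>.\<close>

lemma depth_harnack:
  assumes r: "0 < r" "ball (re_vec z) r \<subseteq> C" "ball (re_vec z') r \<subseteq> C"
    and "norm (z' - z) \<le> real N * r / 3"
  shows "depth (F z) / 2 ^ N \<le> depth (F z')"
  using assms(3,4)
proof (induction N arbitrary: z')
  case 0
  then show ?case by simp
next
  case (Suc N)
  define z1 where "z1 = z' + (1 / real (Suc N)) *\<^sub>R (z - z')"
  have re1: "re_vec z1 = re_vec z' + (1 / real (Suc N)) *\<^sub>R (re_vec z - re_vec z')"
    by (simp only: z1_def re_vec_linear)
  have b1: "ball (re_vec z1) r \<subseteq> C"
    unfolding re1 by (rule ball_convex_combination[OF C(2) Suc.prems(1) r(2)]) auto
  have "z1 - z = (real N / real (Suc N)) *\<^sub>R (z' - z)"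
  proof -
    have "real N / real (Suc N) = 1 - 1 / real (Suc N)" by (simp add: field_simps)
    then show ?thesis by (simp only: z1_def) (simp add: algebra_simps)
  qed
  then have "norm (z1 - z) = real N / real (Suc N) * norm (z' - z)" by simp
  also have "\<dots> \<le> real N / real (Suc N) * (real (Suc N) * r / 3)"
    by (intro mult_left_mono Suc.prems(2)) auto
  finally have "depth (F z) / 2 ^ N \<le> depth (F z1)"
    by (intro Suc.IH b1) simp
  moreover have "depth (F z1) / 2 \<le> depth (F z')"
  proof (rule depth_harnack_step[OF r(1) ball_subset_tube[OF b1]])
    have "norm (z' - z1) = (1 / real (Suc N)) * norm (z' - z)"
      by (simp add: z1_def norm_minus_commute)
    also have "\<dots> \<le> (1 / real (Suc N)) * (real (Suc N) * r / 3)"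
      by (intro mult_left_mono Suc.prems(2)) auto
    finally show "norm (z' - z1) \<le> r / 3" by simp
  qed
  ultimately show ?case by simp
qed

text \<open>A Cauchy estimate: \<open>H\<close> maps a disc of radius \<open>depth w / norm e\<close> in the direction \<open>e\<close> to the tube,
where the real parts of the coordinates are bounded. The imaginary parts are not, hence the half-plane form.\<close>

lemma cderiv_inverse_upper:
  obtains M where "M > 0" "\<And>w e. w \<in> D \<Longrightarrow> norm (cderiv H w e) \<le> M * norm e / depth w"
proof -
  obtain R where R: "R > 0" "\<And>x. x \<in> C \<Longrightarrow> norm x < R"
    using C(3) unfolding bounded_pos by (metis gt_ex le_less_trans less_trans)
  define M where "M = real CARD('n) * (4 * R)"
  have "norm (cderiv H w e) \<le> M * norm e / depth w" if w: "w \<in> D" for w e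
  proof (cases "e = 0")
    case True
    have "cderiv H w 0 = 0" using cderiv(2)[OF H(1) w, of 0 0] by simp
    then show ?thesis using True by simp
  next
    case False
    define s where "s = depth w / norm e"
    have s: "s > 0" using depth_pos[OF w] False by (simp add: s_def)
    have cD: "w + \<zeta> *s e \<in> D" if "\<zeta> \<in> ball 0 s" for \<zeta>
    proof -
      have "norm (\<zeta> *s e) < depth w" using that False by (simp add: norm_cscale s_def field_simps)
      then show ?thesis using ball_depth[of w] by (auto simp: dist_norm)
    qed
    have cd: "curve_deriv (\<lambda>\<zeta>. H (w + \<zeta> *s e)) (cderiv H (w + \<zeta> *s e) e) \<zeta>" if "\<zeta> \<in> ball 0 s" for \<zeta>
      by (rule curve_deriv_compose[OF H(1) cD[OF that] curve_deriv_affine])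
    have comp: "norm (cderiv H w e $ i) \<le> 4 * R / s" for i
    proof -
      define h where "h \<zeta> = of_real R + H (w + \<zeta> *s e) $ i" for \<zeta>
      have Re: "\<bar>Re (H (w + \<zeta> *s e) $ i)\<bar> < R" if "\<zeta> \<in> ball 0 s" for \<zeta>
      proof -
        have "re_vec (H (w + \<zeta> *s e)) \<in> C" using H(2)[OF cD[OF that]] by (simp add: tube_eq)
        then have "\<bar>re_vec (H (w + \<zeta> *s e)) $ i\<bar> < R"
          using R(2) component_le_norm_cart le_less_trans by blast
        then show ?thesis by (simp add: re_vec_def)
      qed
      have "h holomorphic_on ball 0 s"
        unfolding h_def by (intro holomorphic_intros holomorphic_on_curve(3)) (use cd in blast)+
      moreover have "0 < Re (h \<zeta>)" if "\<zeta> \<in> ball 0 s" for \<zeta>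
        using Re[OF that] by (simp add: h_def abs_less_iff)
      ultimately have "norm (deriv h 0) \<le> 2 * Re (h 0) / s"
        by (intro schwarz_right_half_plane(1)[OF _ s]) auto
      also have "\<dots> \<le> 2 * (2 * R) / s"
        using Re[of 0] s by (intro divide_right_mono mult_left_mono) (auto simp: h_def abs_less_iff)
      also have "deriv h 0 = cderiv H w e $ i"
      proof (rule DERIV_imp_deriv)
        have "curve_deriv (\<lambda>\<zeta>. H (w + \<zeta> *s e)) (cderiv H w e) 0" using cd[of 0] s by simp
        from curve_deriv_component[OF this, of i]
        show "(h has_field_derivative cderiv H w e $ i) (at 0)"
          unfolding h_def by (auto intro!: derivative_eq_intros)
      qed
      finally show ?thesis by simp
    qed
    have "norm (cderiv H w e) \<le> (\<Sum>i\<in>UNIV. norm (cderiv H w e $ i))"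
      unfolding norm_vec_def by (rule L2_set_le_sum) auto
    also have "\<dots> \<le> real CARD('n) * (4 * R / s)"
      by (rule order_trans[OF sum_bounded_above[OF comp]]) simp
    finally show ?thesis by (simp add: M_def s_def)
  qed
  moreover have "M > 0" using R by (simp add: M_def)
  ultimately show ?thesis using that by blast
qed

lemma cderiv_F_H:
  assumes w: "w \<in> D"
  shows "cderiv F (H w) (cderiv H w e) = e"
proof -
  have "((\<lambda>x. F (H x)) has_derivative (\<lambda>e. cderiv F (H w) (cderiv H w e))) (at w)"
    using diff_chain_at[OF cderiv(1)[OF H(1) w] cderiv(1)[OF F(1) H(2)[OF w]]] by (simp add: o_def)
  moreover have "((\<lambda>x. F (H x)) has_derivative (\<lambda>e. e)) (at w)"
    by (rule has_derivative_transform_within_open[OF has_derivative_ident D(1) w]) (simp add: FH)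
  ultimately have "(\<lambda>e. cderiv F (H w) (cderiv H w e)) = (\<lambda>e. e)"
    by (rule has_derivative_unique)
  then show ?thesis by metis
qed

text \<open>A Koebe-type estimate for convex images. Let \<open>q\<close> be a point of the complement of \<open>D\<close> nearest to \<open>F z\<close>
and \<open>a\<close> the normal of a supporting hyperplane there. The positive function \<open>a \<bullet> (q - F)\<close> is at most
\<open>norm a * depth (F z)\<close> at \<open>z\<close>, which bounds its derivative, while the derivative along \<open>H' e\<close> for
\<open>e = a / norm a\<close> is exactly \<open>- norm a\<close>.\<close>

lemma cderiv_inverse_lower:
  assumes r: "0 < r" "ball z r \<subseteq> tube C"
  obtains e where "norm e = 1" "r / (2 * depth (F z)) \<le> norm (cderiv H (F z) e)"
proof -
  have zt: "z \<in> tube C" using r by auto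
  have w: "F z \<in> D" using F(2)[OF zt] .
  obtain q where q: "q \<in> - D" "depth (F z) = dist (F z) q"
    using infdist_attains_inf[OF compl_D(2,1)] unfolding depth_def by blast
  obtain a b where ab: "a \<noteq> 0" "\<And>x. x \<in> D \<Longrightarrow> a \<bullet> x \<le> b" "b \<le> a \<bullet> q"
    using separating_hyperplane_sets[of D "{q}"] D(2) q(1) w by auto
  have strict: "a \<bullet> x < a \<bullet> q" if "x \<in> D" for x
    by (rule linear_functional_strict_on_open[OF D(1) ab(1) _ that]) (use ab(2,3) in force)
  define e where "e = (1 / norm a) *\<^sub>R a"
  define E where "E = cderiv H (F z) e"
  have FE: "cderiv F z E = e" using cderiv_F_H[OF w, of e] by (simp add: E_def HF[OF zt])
  have ne: "norm e = 1" using ab(1) by (simp add: e_def)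
  have "E \<noteq> 0"
  proof
    assume "E = 0"
    then have "e = 0" using FE cderiv(2)[OF F(1) zt, of 0 0] by simp
    then show False using ne by simp
  qed
  then have s: "r / norm E > 0" using r(1) by simp
  have ct: "z + \<zeta> *s E \<in> tube C" if "\<zeta> \<in> ball 0 (r / norm E)" for \<zeta>
  proof -
    have "norm (\<zeta> *s E) < r" using that \<open>E \<noteq> 0\<close> by (simp add: norm_cscale field_simps)
    then show ?thesis using r(2) by (auto simp: dist_norm)
  qed
  have cd: "curve_deriv (\<lambda>\<zeta>. F (z + \<zeta> *s E)) (cderiv F (z + \<zeta> *s E) E) \<zeta>"
    if "\<zeta> \<in> ball 0 (r / norm E)" for \<zeta>
    by (rule curve_deriv_compose[OF F(1) ct[OF that] curve_deriv_affine])
  define h where "h \<zeta> = of_real (a \<bullet> q) - (\<Sum>i\<in>UNIV. cnj (a $ i) * F (z + \<zeta> *s E) $ i)" for \<zeta>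
  have "h holomorphic_on ball 0 (r / norm E)"
    unfolding h_def by (intro holomorphic_intros holomorphic_on_curve(2)) (use cd in blast)+
  moreover have "0 < Re (h \<zeta>)" if "\<zeta> \<in> ball 0 (r / norm E)" for \<zeta>
    using strict[OF F(2)[OF ct[OF that]]] by (simp add: h_def inner_eq_Re)
  ultimately have "norm (deriv h 0) \<le> 2 * Re (h 0) / (r / norm E)"
    by (intro schwarz_right_half_plane(1)[OF _ s]) auto
  also have "Re (h 0) = a \<bullet> (q - F z)" by (simp add: h_def inner_eq_Re right_diff_distrib sum_subtractf)
  also have "deriv h 0 = - (\<Sum>i\<in>UNIV. cnj (a $ i) * e $ i)"
  proof (rule DERIV_imp_deriv)
    have "curve_deriv (\<lambda>\<zeta>. F (z + \<zeta> *s E)) e 0" using cd[of 0] s FE by simp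
    from DERIV_diff[OF DERIV_const inner_curve_deriv[OF this, of a]]
    show "(h has_field_derivative - (\<Sum>i\<in>UNIV. cnj (a $ i) * e $ i)) (at 0)"
      unfolding h_def by simp
  qed
  finally have 1: "norm (\<Sum>i\<in>UNIV. cnj (a $ i) * e $ i) \<le> 2 * (a \<bullet> (q - F z)) / (r / norm E)"
    by simp
  have "norm a = a \<bullet> e" using ab(1) by (simp add: e_def power2_norm_eq_inner[symmetric] power2_eq_square)
  also have "\<dots> \<le> norm (\<Sum>i\<in>UNIV. cnj (a $ i) * e $ i)"
    unfolding inner_eq_Re by (rule complex_Re_le_cmod)
  also note 1
  also have "2 * (a \<bullet> (q - F z)) / (r / norm E) \<le> 2 * (norm a * depth (F z)) / (r / norm E)"
    using s norm_cauchy_schwarz[of a "q - F z"]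
    by (intro divide_right_mono mult_left_mono) (auto simp: q(2) dist_norm norm_minus_commute)
  finally have "norm a * r \<le> norm a * (2 * depth (F z) * norm E)"
    using r(1) \<open>E \<noteq> 0\<close> by (simp add: field_simps)
  then have "r \<le> 2 * depth (F z) * norm E" using ab(1) by simp
  then have "r / (2 * depth (F z)) \<le> norm E" using depth_pos[OF w] by (simp add: field_simps)
  then show ?thesis using that ne unfolding E_def by blast
qed

section \<open>Monotonicity along the axis of a chord\<close>

text \<open>For \<open>t > 0\<close> small, \<open>w + t \<kappa> (p - w)\<close> stays in \<open>D\<close>: it is a convex combination of \<open>w\<close> and the point
\<open>p + \<i> (Im \<kappa> / Re \<kappa>) (p - w)\<close>, which is in the ball around \<open>p\<close> because \<open>\<kappa>\<close> has values in a narrow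
sector. Composing the strip, \<open>F\<close>, this motion, \<open>H\<close> and \<open>n\<close> yields a self-map of the unit strip that
is the identity for \<open>t = 0\<close>. On the axis it does not increase distances, and the derivative of
this inequality at \<open>t = 0\<close> is the assertion.\<close>

lemma generator_monotone:
  fixes \<eta> :: "real ^ 'n"
  assumes ch: "supporting_chord C n a v"
    and \<kappa>: "\<kappa> holomorphic_on unit_strip"
      "\<And>\<zeta>. \<zeta> \<in> unit_strip \<Longrightarrow> 0 \<le> Re (\<kappa> \<zeta>)" "\<And>\<zeta>. \<zeta> \<in> unit_strip \<Longrightarrow> Re (\<kappa> \<zeta>) \<le> M"
      "\<And>\<zeta>. \<zeta> \<in> unit_strip \<Longrightarrow> \<bar>Im (\<kappa> \<zeta>)\<bar> \<le> g * Re (\<kappa> \<zeta>)"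
    and M: "0 < M"
    and p: "ball p \<rho> \<subseteq> D" "\<And>w. w \<in> D \<Longrightarrow> \<bar>g\<bar> * norm (p - w) < \<rho>"
    and "S \<le> T"
  defines "z \<equiv> \<lambda>T. cvec (a + (1/2) *\<^sub>R v) (\<eta> + T *\<^sub>R v)"
  defines "X \<equiv> \<lambda>T. \<kappa> (Complex (1/2) T) *s (p - F (z T))"
  shows "Im (cdot n (cderiv H (F (z T)) (X T))) \<le> Im (cdot n (cderiv H (F (z S)) (X S)))"
proof -
  define \<gamma> where "\<gamma> \<zeta> = cvec a \<eta> + \<zeta> *s cvec v 0" for \<zeta>
  have \<gamma>C: "\<gamma> \<zeta> \<in> tube C" if "\<zeta> \<in> unit_strip" for \<zeta>
    using ch that by (simp add: \<gamma>_def tube_eq re_vec_linear cvec_linear supporting_chord_def)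
  have \<gamma>mid: "\<gamma> (Complex (1/2) T) = z T" for T
    by (simp add: \<gamma>_def z_def cvec_linear)
  have mid: "Complex (1/2) T \<in> unit_strip" for T by simp
  have zC: "z T \<in> tube C" for T using \<gamma>C[OF mid[of T]] \<gamma>mid by simp
  obtain x0 where x0: "x0 \<in> C" using C(4) by blast
  have nv: "n \<bullet> v > 0" using ch x0 by (force simp: supporting_chord_def inner_add_right)
  \<comment> \<open>When \<open>Re \<kappa> = 0\<close> the sector condition forces \<open>\<kappa> = 0\<close>, which matches the value 0 of \<open>Im \<kappa> / Re \<kappa>\<close>.\<close>
  have inD: "F (\<gamma> \<zeta>) + (of_real t * \<kappa> \<zeta>) *s (p - F (\<gamma> \<zeta>)) \<in> D"
    if \<zeta>: "\<zeta> \<in> unit_strip" and t: "0 < t" "t \<le> 1 / M" for \<zeta> t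
  proof -
    define w k1 k2 where "w = F (\<gamma> \<zeta>)" and "k1 = Re (\<kappa> \<zeta>)" and "k2 = Im (\<kappa> \<zeta>)"
    have w: "w \<in> D" unfolding w_def using F(2) \<gamma>C[OF \<zeta>] by blast
    have k: "0 \<le> k1" "k1 \<le> M" "\<bar>k2\<bar> \<le> g * k1" using \<kappa>(2-4)[OF \<zeta>] by (auto simp: k1_def k2_def)
    define p' where "p' = p + (\<i> * of_real (k2 / k1)) *s (p - w)"
    have "\<bar>k2 / k1\<bar> \<le> \<bar>g\<bar>"
    proof (cases "k1 = 0")
      case False
      then have "0 < k1" using k(1) by simp
      moreover have "g * k1 \<le> \<bar>g\<bar> * k1" using k(1) by (intro mult_right_mono) auto
      ultimately have "\<bar>k2\<bar> \<le> \<bar>g\<bar> * k1" using k(3) by linarith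
      with \<open>0 < k1\<close> show ?thesis by (simp add: abs_divide divide_le_eq)
    qed simp
    then have "\<bar>k2 / k1\<bar> * norm (p - w) \<le> \<bar>g\<bar> * norm (p - w)" by (rule mult_right_mono) simp
    moreover have "norm (p' - p) = \<bar>k2 / k1\<bar> * norm (p - w)"
      unfolding p'_def add_diff_cancel_left' norm_cscale norm_mult norm_of_real by simp
    ultimately have "norm (p' - p) \<le> \<bar>g\<bar> * norm (p - w)" by simp
    also have "\<dots> < \<rho>" by (rule p(2)[OF w])
    finally have p'D: "p' \<in> D" using p(1) by (auto simp: dist_norm norm_minus_commute)
    have tk: "0 \<le> t * k1" "t * k1 \<le> 1"
    proof -
      show "0 \<le> t * k1" using t k by simp
      have "t * k1 \<le> (1 / M) * M" using t k M by (intro mult_mono) auto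
      then show "t * k1 \<le> 1" using M by simp
    qed
    have "(1 - t * k1) *\<^sub>R w + (t * k1) *\<^sub>R p' \<in> D"
      using D(2) w p'D tk by (simp add: convex_def)
    moreover have "k1 = 0 \<Longrightarrow> k2 = 0" using k(3) by simp
    then have "(1 - t * k1) *\<^sub>R w + (t * k1) *\<^sub>R p' = w + (of_real t * \<kappa> \<zeta>) *s (p - w)"
      unfolding p'_def
      by (cases "k1 = 0")
         (auto simp: vec_eq_iff complex_eq_iff k1_def k2_def algebra_simps)
    ultimately show ?thesis by (simp add: w_def)
  qed
  have \<gamma>d: "curve_deriv \<gamma> (cvec v 0) \<zeta>" for \<zeta>
    using curve_deriv_affine[of "cvec a \<eta>" "cvec v 0" \<zeta>] unfolding \<gamma>_def[abs_def] .
  have qd: "\<exists>u. curve_deriv (\<lambda>\<zeta>. H (F (\<gamma> \<zeta>) + (of_real t * \<kappa> \<zeta>) *s (p - F (\<gamma> \<zeta>)))) u \<zeta>"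
    if \<zeta>: "\<zeta> \<in> unit_strip" and t: "0 < t" "t \<le> 1 / M" for \<zeta> t
  proof -
    have 1: "curve_deriv (\<lambda>\<zeta>. F (\<gamma> \<zeta>)) (cderiv F (\<gamma> \<zeta>) (cvec v 0)) \<zeta>"
      by (rule curve_deriv_compose[OF F(1) \<gamma>C[OF \<zeta>] \<gamma>d])
    have "((\<lambda>\<zeta>. of_real t * \<kappa> \<zeta>) has_field_derivative of_real t * deriv \<kappa> \<zeta>) (at \<zeta>)"
      by (rule DERIV_cmult[OF holomorphic_derivI[OF \<kappa>(1) open_unit_strip \<zeta>]])
    from curve_deriv_add[OF 1 curve_deriv_cscale[OF this curve_deriv_diff[OF curve_deriv_const[of p] 1]]]
    obtain u where "curve_deriv (\<lambda>\<zeta>. F (\<gamma> \<zeta>) + (of_real t * \<kappa> \<zeta>) *s (p - F (\<gamma> \<zeta>))) u \<zeta>"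
      by blast
    from curve_deriv_compose[where c="\<lambda>\<zeta>. F (\<gamma> \<zeta>) + (of_real t * \<kappa> \<zeta>) *s (p - F (\<gamma> \<zeta>))",
        OF H(1) inD[OF \<zeta> t] this]
    show ?thesis by blast
  qed
  define \<phi> where "\<phi> T t = Im (cdot n (H (F (z T) + of_real t *s X T)))" for T t
  have \<phi>0: "\<phi> T 0 = n \<bullet> (\<eta> + T *\<^sub>R v)" for T
  proof -
    have "\<phi> T 0 = Im (cdot n (z T))" by (simp add: \<phi>_def HF[OF zC])
    then show ?thesis by (simp add: z_def cdot_cvec)
  qed
  have le: "\<phi> T t - \<phi> S t \<le> (T - S) * (n \<bullet> v)" if t: "0 < t" "t \<le> 1 / M" for t
  proof -
    define G where "G \<zeta> = (cdot n (H (F (\<gamma> \<zeta>) + (of_real t * \<kappa> \<zeta>) *s (p - F (\<gamma> \<zeta>)))) - of_real (n \<bullet> a)) / of_real (n \<bullet> v)" for \<zeta>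
    have "G holomorphic_on unit_strip"
      unfolding G_def
      by (intro holomorphic_intros holomorphic_on_curve(1) open_unit_strip qd t) (use nv in auto)
    moreover have "G ` unit_strip \<subseteq> unit_strip"
    proof (rule image_subsetI)
      fix \<zeta> assume \<zeta>: "\<zeta> \<in> unit_strip"
      define y where "y = re_vec (H (F (\<gamma> \<zeta>) + (of_real t * \<kappa> \<zeta>) *s (p - F (\<gamma> \<zeta>))))"
      have "y \<in> C" unfolding y_def using H(2)[OF inD[OF \<zeta> t]] by (simp add: tube_eq)
      then have "n \<bullet> a < n \<bullet> y" "n \<bullet> y < n \<bullet> a + n \<bullet> v"
        using ch by (auto simp: supporting_chord_def inner_add_right)
      moreover have "Re (G \<zeta>) = (n \<bullet> y - n \<bullet> a) / (n \<bullet> v)"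
        by (simp add: G_def Re_cdot y_def)
      ultimately show "G \<zeta> \<in> unit_strip" using nv by (simp add: divide_less_eq)
    qed
    ultimately have 1: "Im (G (Complex (1/2) T)) - Im (G (Complex (1/2) S)) \<le> T - S"
      by (rule strip_self_map_Im_le[OF _ _ \<open>S \<le> T\<close>])
    have "Im (G (Complex (1/2) T)) = \<phi> T t / (n \<bullet> v)" for T
      by (simp add: G_def \<phi>_def X_def \<gamma>mid vector_smult_assoc)
    with 1 have "(\<phi> T t - \<phi> S t) / (n \<bullet> v) \<le> T - S" by (simp add: diff_divide_distrib)
    then show ?thesis using nv by (simp add: divide_le_eq)
  qed
  have d\<phi>: "(\<phi> T has_real_derivative Im (cdot n (cderiv H (F (z T)) (X T)))) (at 0)" for T
    unfolding \<phi>_def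
  proof (rule Im_along_reals_derivative[where f="\<lambda>\<zeta>. cdot n (H (F (z T) + \<zeta> *s X T))"], rule cdot_curve_deriv)
    have "F (z T) + 0 *s X T \<in> D" using F(2)[OF zC] by simp
    from curve_deriv_compose[where c="\<lambda>\<zeta>. F (z T) + \<zeta> *s X T", OF H(1) this curve_deriv_affine]
    show "curve_deriv (\<lambda>\<zeta>. H (F (z T) + \<zeta> *s X T)) (cderiv H (F (z T)) (X T)) 0" by simp
  qed
  have "0 \<le> Im (cdot n (cderiv H (F (z S)) (X S))) - Im (cdot n (cderiv H (F (z T)) (X T)))"
  proof (rule right_derivative_nonneg[OF DERIV_diff[OF d\<phi> d\<phi>]])
    show "0 < 1 / M" using M by simp
    fix t assume "0 < t" "t \<le> 1 / M"
    then show "\<phi> S 0 - \<phi> T 0 \<le> \<phi> S t - \<phi> T t"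
      using le[of t] by (simp add: \<phi>0 inner_add_right algebra_simps)
  qed
  then show ?thesis by simp
qed

text \<open>A monotone function is bounded by its values at the two ends \<open>\<pm>L\<close>, where the weight contributes
\<open>exp(-c L)\<close>. This controls only the imaginary part, and only vectors of the form \<open>p - F z\<close>. Taking
differences over two points \<open>p\<close> gives all small vectors \<open>e\<close>, and \<open>\<i> e\<close> in place of \<open>e\<close> gives the real part.\<close>

lemma normal_component_decay:
  obtains c K \<rho> where "0 < c" "0 < K" "0 < \<rho>"
    and "\<And>n a v \<eta> e L. supporting_chord C n a v \<Longrightarrow> norm e < \<rho> \<Longrightarrow> 0 \<le> L \<Longrightarrow>
      norm (cdot n (cderiv H (F (cvec (a + (1/2) *\<^sub>R v) \<eta>)) e)) \<le>
        K * norm n * exp (- c * L) *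
         (1 / depth (F (cvec (a + (1/2) *\<^sub>R v) (\<eta> + L *\<^sub>R v)))
          + 1 / depth (F (cvec (a + (1/2) *\<^sub>R v) (\<eta> - L *\<^sub>R v))))"
proof -
  obtain x0 where x0: "x0 \<in> C" using C(4) by blast
  define p0 where "p0 = F (cvec x0 0)"
  have "p0 \<in> D" unfolding p0_def by (rule F(2)) (simp add: tube_eq x0)
  then obtain r0 where r0: "r0 > 0" "ball p0 r0 \<subseteq> D" using D(1) openE by blast
  define \<rho> where "\<rho> = r0 / 2"
  have \<rho>: "\<rho> > 0" using r0 by (simp add: \<rho>_def)
  obtain B where B: "B > 0" "\<And>x y. x \<in> D \<Longrightarrow> y \<in> D \<Longrightarrow> norm (x - y) \<le> B"
  proof -
    obtain b where b: "b > 0" "\<And>x. x \<in> D \<Longrightarrow> norm x \<le> b" using D(3) unfolding bounded_pos by blast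
    have "norm (x - y) \<le> 2 * b" if "x \<in> D" "y \<in> D" for x y
      using norm_triangle_ineq4[of x y] b(2)[OF that(1)] b(2)[OF that(2)] by linarith
    then show ?thesis using that[of "2 * b"] b(1) by auto
  qed
  obtain M where M: "M > 0" "\<And>w e. w \<in> D \<Longrightarrow> norm (cderiv H w e) \<le> M * norm e / depth w"
    using cderiv_inverse_upper by blast
  \<comment> \<open>Small enough that a sector of slope \<open>c\<close> moves points of \<open>D\<close> by less than \<open>\<rho>\<close>.\<close>
  define c where "c = min 1 (\<rho> / (2 * B))"
  have c: "0 < c" "c \<le> 1" using \<rho> B(1) by (auto simp: c_def)
  have cB: "c * B < \<rho>"
  proof -
    have "c * B \<le> \<rho> / (2 * B) * B" using B(1) by (intro mult_right_mono) (auto simp: c_def)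
    also have "\<dots> = \<rho> / 2" using B(1) by simp
    finally show ?thesis using \<rho> by simp
  qed
  show ?thesis
  proof (rule that[OF c(1) _ \<rho>])
    show "0 < 8 * M * B" using M B by simp
    fix n a v \<eta> :: "real^'n" and e :: "complex^'n" and L :: real
    assume ch: "supporting_chord C n a v" and e: "norm e < \<rho>" and L: "0 \<le> L"
    define z where "z T = cvec (a + (1/2) *\<^sub>R v) (\<eta> + T *\<^sub>R v)" for T
    have zD: "F (z T) \<in> D" for T
      by (rule F(2)) (use ch in \<open>simp add: z_def tube_eq supporting_chord_def\<close>)
    define Q where "Q = 1 / depth (F (z L)) + 1 / depth (F (z (- L)))"
    have pos: "1 / depth (F (z T)) > 0" for T using depth_pos[OF zD] by simp
    have one: "\<bar>Im (cdot n (cderiv H (F (z 0)) (p - F (z 0))))\<bar> \<le> norm n * (2 * exp (- c * L) * M * B) * Q"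
      if p: "p \<in> ball p0 \<rho>" for p
    proof -
      have pb: "ball p \<rho> \<subseteq> D"
      proof
        fix x assume "x \<in> ball p \<rho>"
        then have "x \<in> ball p0 r0" using p dist_triangle[of p0 x p] by (simp add: \<rho>_def)
        then show "x \<in> D" using r0 by blast
      qed
      then have pD: "p \<in> D" using \<rho> by auto
      define \<alpha> where "\<alpha> T = Im (cdot n (cderiv H (F (z T)) (strip_weight c (Complex (1/2) T) *s (p - F (z T)))))" for T
      have mono: "\<alpha> T \<le> \<alpha> S" if "S \<le> T" for S T
        unfolding \<alpha>_def z_def
      proof (rule generator_monotone[OF ch, where M=2 and g=c and \<rho>=\<rho>])
        show "\<bar>c\<bar> * norm (p - w) < \<rho>" if "w \<in> D" for w
        proof -
          have "c * norm (p - w) \<le> c * B" using B(2)[OF pD that] c(1) by (intro mult_left_mono) auto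
          then have "c * norm (p - w) < \<rho>" using cB by (rule le_less_trans)
          then show ?thesis using c(1) by simp
        qed
      qed (use strip_weight_holomorphic strip_weight c pb \<open>S \<le> T\<close> in auto)
      have bd: "\<bar>\<alpha> T\<bar> \<le> norm n * (2 * exp (- c * L) * M * B) * (1 / depth (F (z T)))" if "\<bar>T\<bar> = L" for T
      proof -
        have "cosh (c * T) = cosh (c * L)"
          using that by (cases "0 \<le> T") auto
        then have "norm (strip_weight c (Complex (1/2) T)) = inverse (cosh (c * L))"
          by (simp only: strip_weight_mid norm_of_real abs_of_nonneg[OF less_imp_le[OF positive_imp_inverse_positive[OF cosh_real_pos]]])
        then have w: "norm (strip_weight c (Complex (1/2) T)) \<le> 2 * exp (- c * L)"
          using inverse_cosh_le[of "c * L"] by simp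
        have "\<bar>\<alpha> T\<bar> \<le> norm n * norm (cderiv H (F (z T)) (strip_weight c (Complex (1/2) T) *s (p - F (z T))))"
          unfolding \<alpha>_def by (rule order_trans[OF abs_Im_le_cmod norm_cdot_le])
        also have "\<dots> \<le> norm n * (M * norm (strip_weight c (Complex (1/2) T) *s (p - F (z T))) / depth (F (z T)))"
          by (intro mult_left_mono M(2) zD) auto
        also have "\<dots> \<le> norm n * (M * (2 * exp (- c * L) * B) / depth (F (z T)))"
          unfolding norm_cscale
          using M(1) w B(2)[OF pD zD] depth_pos[OF zD, of T]
          by (intro mult_left_mono divide_right_mono mult_mono) auto
        finally show ?thesis by (simp add: algebra_simps)
      qed
      have E: "0 \<le> norm n * (2 * exp (- c * L) * M * B)" using M(1) B(1) by simp
      have "\<bar>\<alpha> 0\<bar> \<le> \<bar>\<alpha> L\<bar> + \<bar>\<alpha> (- L)\<bar>" using mono[of 0 L] mono[of "- L" 0] L by auto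
      also have "\<dots> \<le> norm n * (2 * exp (- c * L) * M * B) * Q"
        using bd[of L] bd[of "- L"] L by (simp add: Q_def distrib_left)
      also have "\<alpha> 0 = Im (cdot n (cderiv H (F (z 0)) (p - F (z 0))))"
        by (simp add: \<alpha>_def strip_weight_mid)
      finally show ?thesis .
    qed
    have im: "\<bar>Im (cdot n (cderiv H (F (z 0)) e'))\<bar> \<le> 2 * (norm n * (2 * exp (- c * L) * M * B) * Q)"
      if "norm e' < \<rho>" for e'
    proof -
      have 1: "p0 + e' \<in> ball p0 \<rho>" "p0 \<in> ball p0 \<rho>" using that \<rho> by (auto simp: dist_norm)
      have "cderiv H (F (z 0)) e' = cderiv H (F (z 0)) (p0 + e' - F (z 0)) - cderiv H (F (z 0)) (p0 - F (z 0))"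
        using cderiv(4)[OF H(1) zD, of 0 "p0 + e' - F (z 0)" "p0 - F (z 0)"] by simp
      then show ?thesis using one[OF 1(1)] one[OF 1(2)] by (simp add: cdot_linear)
    qed
    have "norm (\<i> *s e) < \<rho>" using e by (simp add: norm_cscale)
    from im[OF this] have re: "\<bar>Re (cdot n (cderiv H (F (z 0)) e))\<bar> \<le> 2 * (norm n * (2 * exp (- c * L) * M * B) * Q)"
      by (simp add: cderiv(2)[OF H(1) zD] cdot_linear)
    have "norm (cdot n (cderiv H (F (z 0)) e)) \<le> 4 * (norm n * (2 * exp (- c * L) * M * B) * Q)"
      using cmod_le[of "cdot n (cderiv H (F (z 0)) e)"] re im[OF e] by linarith
    then show "norm (cdot n (cderiv H (F (cvec (a + (1/2) *\<^sub>R v) \<eta>)) e)) \<le>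
        8 * M * B * norm n * exp (- c * L) *
         (1 / depth (F (cvec (a + (1/2) *\<^sub>R v) (\<eta> + L *\<^sub>R v)))
          + 1 / depth (F (cvec (a + (1/2) *\<^sub>R v) (\<eta> - L *\<^sub>R v))))"
      by (simp add: z_def Q_def mult_ac)
  qed
qed

section \<open>Comparison and growth along the tube\<close>

lemma cvec_in_tube: "x \<in> C \<Longrightarrow> cvec x y \<in> tube C"
  by (simp add: tube_eq)

text \<open>One number of Harnack steps suffices for all \<open>x\<close> in \<open>X\<close> and all imaginary parts at once, because the
tube is invariant under imaginary translations.\<close>

lemma depth_compare:
  assumes X: "compact X" "X \<subseteq> C" and y: "y \<in> C"
  obtains k where "0 < k"
    "\<And>x \<eta> \<eta>'. x \<in> X \<Longrightarrow> norm (\<eta>' - \<eta>) \<le> B \<Longrightarrow>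
       1 / depth (F (cvec x \<eta>')) \<le> k * (1 / depth (F (cvec y \<eta>)))"
proof -
  obtain r where r: "0 < r" "\<And>x. x \<in> insert y X \<Longrightarrow> ball x r \<subseteq> C"
    using compact_uniform_ball[of "insert y X" C] X y C(1) by auto
  obtain R where R: "\<And>x. x \<in> X \<Longrightarrow> norm x \<le> R"
    using compact_imp_bounded[OF X(1)] unfolding bounded_iff by blast
  obtain N where N: "(R + norm y + B) * 3 / r \<le> real N" using real_arch_simple by blast
  show ?thesis
  proof (rule that)
    show "(0::real) < 2 ^ N" by simp
    fix x \<eta> \<eta>' :: "real ^ 'n" assume x: "x \<in> X" and \<eta>: "norm (\<eta>' - \<eta>) \<le> B"
    have "norm (cvec x \<eta>' - cvec y \<eta>) \<le> norm (x - y) + norm (\<eta>' - \<eta>)"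
      unfolding cvec_linear by (rule norm_cvec_le)
    also have "\<dots> \<le> R + norm y + B"
      using norm_triangle_ineq4[of x y] R[OF x] \<eta> by linarith
    also have "\<dots> \<le> real N * r / 3" using N r(1) by (simp add: field_simps)
    finally have "depth (F (cvec y \<eta>)) / 2 ^ N \<le> depth (F (cvec x \<eta>'))"
      by (intro depth_harnack[OF r(1)]) (use r(2) x in auto)
    moreover have "0 < depth (F (cvec y \<eta>))" "0 < depth (F (cvec x \<eta>'))"
      using depth_pos[OF F(2)[OF cvec_in_tube]] y x X(2) by auto
    ultimately show "1 / depth (F (cvec x \<eta>')) \<le> 2 ^ N * (1 / depth (F (cvec y \<eta>)))"
      by (simp add: field_simps)
  qed
qed

text \<open>The number of Harnack steps needed to reach imaginary part \<open>\<eta>\<close> is about \<open>3 norm \<eta> / r\<close>, and each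
costs a factor of \<open>2 < exp 1\<close>.\<close>

lemma inverse_depth_growth:
  assumes "y \<in> C"
  obtains b where "0 \<le> b"
    "\<And>\<eta>. 1 / depth (F (cvec y \<eta>)) \<le> 1 / depth (F (cvec y 0)) * exp (b * norm \<eta> + 1)"
proof -
  obtain r where r: "0 < r" "ball y r \<subseteq> C" using assms C(1) openE by blast
  show ?thesis
  proof (rule that)
    show "0 \<le> 3 / r" using r by simp
    fix \<eta> :: "real ^ 'n"
    define N where "N = nat \<lceil>3 / r * norm \<eta>\<rceil>"
    have N: "3 / r * norm \<eta> \<le> real N" "real N \<le> 3 / r * norm \<eta> + 1"
      using r(1) of_int_ceiling_le_add_one[of "3 / r * norm \<eta>"] le_of_int_ceiling[of "3 / r * norm \<eta>"]
      unfolding N_def by auto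
    have "norm (cvec y \<eta> - cvec y 0) \<le> norm \<eta>"
      unfolding cvec_linear using norm_cvec_le[of "y - y" "\<eta> - 0"] by simp
    also have "\<dots> \<le> real N * r / 3" using N(1) r(1) by (simp add: field_simps)
    finally have "depth (F (cvec y 0)) / 2 ^ N \<le> depth (F (cvec y \<eta>))"
      by (intro depth_harnack[OF r(1)]) (use r(2) in auto)
    moreover have pos: "0 < depth (F (cvec y 0))" "0 < depth (F (cvec y \<eta>))"
      using depth_pos[OF F(2)[OF cvec_in_tube]] assms by auto
    ultimately have "1 / depth (F (cvec y \<eta>)) \<le> 1 / depth (F (cvec y 0)) * 2 ^ N"
      by (simp add: field_simps)
    also have "(2::real) ^ N \<le> exp 1 ^ N"
      using exp_ge_add_one_self[of 1] by (intro power_mono) auto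
    also have "exp 1 ^ N = exp (real N)" by (simp add: exp_of_nat_mult[symmetric])
    also have "\<dots> \<le> exp (3 / r * norm \<eta> + 1)" using N(2) by simp
    finally show "1 / depth (F (cvec y \<eta>)) \<le> 1 / depth (F (cvec y 0)) * exp (3 / r * norm \<eta> + 1)"
      using pos by (simp add: divide_right_mono)
  qed
qed

text \<open>The derivative is the pointwise limit of difference quotients of \<open>H\<close>, which are holomorphic in \<open>\<zeta>\<close>.
They are locally bounded by the mean value theorem, because the depth stays bounded below near
each point.\<close>

lemma holomorphic_cderiv_on_line:
  assumes S: "open S" and z: "\<And>\<zeta>. \<zeta> \<in> S \<Longrightarrow> p + \<zeta> *s q \<in> tube C"
  shows "(\<lambda>\<zeta>. cdot n (cderiv H (F (p + \<zeta> *s q)) e)) holomorphic_on S"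
  unfolding holomorphic_on_def
proof
  fix \<zeta>0 assume \<zeta>0: "\<zeta>0 \<in> S"
  obtain M where M: "M > 0" "\<And>w e. w \<in> D \<Longrightarrow> norm (cderiv H w e) \<le> M * norm e / depth w"
    using cderiv_inverse_upper by blast
  obtain r where r: "0 < r" "ball (p + \<zeta>0 *s q) r \<subseteq> tube C"
    using z[OF \<zeta>0] open_tube[OF C(1)] openE by blast
  obtain s1 where s1: "0 < s1" "ball \<zeta>0 s1 \<subseteq> S" using S \<zeta>0 openE by blast
  define s where "s = min s1 (r / (3 * (norm q + 1)))"
  have s: "0 < s" using s1 r by (simp add: s_def add_nonneg_pos)
  define d where "d = depth (F (p + \<zeta>0 *s q)) / 2"
  have d: "0 < d" using depth_pos[OF F(2)[OF z[OF \<zeta>0]]] by (simp add: d_def)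
  have inS: "\<zeta> \<in> S" if "\<zeta> \<in> ball \<zeta>0 s" for \<zeta> using that s1(2) by (auto simp: s_def)
  have deep: "d \<le> depth (F (p + \<zeta> *s q))" if \<zeta>: "\<zeta> \<in> ball \<zeta>0 s" for \<zeta>
    unfolding d_def
  proof (rule depth_harnack_step[OF r])
    have "(p + \<zeta> *s q) - (p + \<zeta>0 *s q) = (\<zeta> - \<zeta>0) *s q"
      by (simp add: vec_eq_iff algebra_simps)
    then have "norm ((p + \<zeta> *s q) - (p + \<zeta>0 *s q)) = norm (\<zeta> - \<zeta>0) * norm q"
      by (simp only: norm_cscale)
    also have "\<dots> \<le> r / (3 * (norm q + 1)) * (norm q + 1)"
      using \<zeta> r(1) by (intro mult_mono) (auto simp: s_def dist_norm norm_minus_commute)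
    also have "\<dots> = r / 3" using norm_ge_zero[of q] by (simp add: field_simps add_nonneg_eq_0_iff)
    finally show "norm ((p + \<zeta> *s q) - (p + \<zeta>0 *s q)) \<le> r / 3" .
  qed
  define \<mu> where "\<mu> k = d / (2 * (norm e + 1)) * inverse (real (Suc k))" for k
  have \<mu>: "0 < \<mu> k" "\<mu> k * norm e \<le> d / 2" for k
  proof -
    show "0 < \<mu> k" using d by (simp add: \<mu>_def add_nonneg_pos)
    have "\<mu> k \<le> d / (2 * (norm e + 1)) * 1"
      unfolding \<mu>_def using d by (intro mult_left_mono) (auto simp: field_simps)
    then have "\<mu> k * norm e \<le> d / (2 * (norm e + 1)) * (norm e + 1)"
      using d by (intro mult_mono) auto
    also have "\<dots> = d / 2" using norm_ge_zero[of e] by (simp add: field_simps add_nonneg_eq_0_iff)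
    finally show "\<mu> k * norm e \<le> d / 2" .
  qed
  have near: "F (p + \<zeta> *s q) + t *s e \<in> D \<and> d / 2 \<le> depth (F (p + \<zeta> *s q) + t *s e)"
    if \<zeta>: "\<zeta> \<in> ball \<zeta>0 s" and t: "norm t \<le> \<mu> k" for \<zeta> t k
  proof -
    have "norm t * norm e \<le> \<mu> k * norm e" using t by (intro mult_right_mono) auto
    then have nt: "norm (t *s e) \<le> d / 2" using \<mu>(2)[of k] by (simp add: norm_cscale)
    have "ball (F (p + \<zeta> *s q) + t *s e) (d / 2) \<subseteq> ball (F (p + \<zeta> *s q)) (depth (F (p + \<zeta> *s q)))"
    proof
      fix y assume "y \<in> ball (F (p + \<zeta> *s q) + t *s e) (d / 2)"
      then have "dist (F (p + \<zeta> *s q)) y < d"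
        using dist_triangle[of "F (p + \<zeta> *s q)" y "F (p + \<zeta> *s q) + t *s e"] nt
        by (simp add: dist_norm)
      then show "y \<in> ball (F (p + \<zeta> *s q)) (depth (F (p + \<zeta> *s q)))" using deep[OF \<zeta>] by simp
    qed
    then have "ball (F (p + \<zeta> *s q) + t *s e) (d / 2) \<subseteq> D" using ball_depth by blast
    moreover from this have "F (p + \<zeta> *s q) + t *s e \<in> D" using d by (meson centre_in_ball half_gt_zero subsetD)
    ultimately show ?thesis using le_depth by blast
  qed
  have Hd: "((\<lambda>t. cdot n (H (F (p + \<zeta> *s q) + t *s e))) has_field_derivative
      cdot n (cderiv H (F (p + \<zeta> *s q) + t *s e) e)) (at t)"
    if "\<zeta> \<in> ball \<zeta>0 s" and "norm t \<le> \<mu> k" for \<zeta> t k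
    by (rule cdot_curve_deriv, rule curve_deriv_compose[OF H(1) _ curve_deriv_affine])
       (use near[OF that] in blast)
  define f where "f k \<zeta> = (cdot n (H (F (p + \<zeta> *s q) + of_real (\<mu> k) *s e)) - cdot n (H (F (p + \<zeta> *s q)))) / of_real (\<mu> k)" for k \<zeta>
  have "(\<lambda>\<zeta>. cdot n (cderiv H (F (p + \<zeta> *s q)) e)) holomorphic_on ball \<zeta>0 s"
  proof (rule holomorphic_pointwise_limit)
    show "f k holomorphic_on ball \<zeta>0 s" for k
    proof -
      have 1: "\<exists>u. curve_deriv (\<lambda>\<zeta>. H (F (p + \<zeta> *s q) + t *s e)) u \<zeta>"
        if \<zeta>: "\<zeta> \<in> ball \<zeta>0 s" and t: "norm t \<le> \<mu> k" for \<zeta> t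
      proof -
        have "curve_deriv (\<lambda>\<zeta>. F (p + \<zeta> *s q)) (cderiv F (p + \<zeta> *s q) q) \<zeta>"
          by (rule curve_deriv_compose[OF F(1) z[OF inS[OF \<zeta>]] curve_deriv_affine])
        from curve_deriv_add[OF this curve_deriv_const[of "t *s e"]]
        have "curve_deriv (\<lambda>\<zeta>. F (p + \<zeta> *s q) + t *s e) (cderiv F (p + \<zeta> *s q) q + 0) \<zeta>" .
        from curve_deriv_compose[where c="\<lambda>\<zeta>. F (p + \<zeta> *s q) + t *s e", OF H(1) _ this] near[OF \<zeta> t]
        show ?thesis by blast
      qed
      have 2: "(\<lambda>\<zeta>. cdot n (H (F (p + \<zeta> *s q) + t *s e))) holomorphic_on ball \<zeta>0 s"
        if "norm t \<le> \<mu> k" for t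
        by (rule holomorphic_on_curve(1)[OF open_ball 1[OF _ that]])
      have "norm (of_real (\<mu> k) :: complex) \<le> \<mu> k" "norm (0::complex) \<le> \<mu> k" using \<mu>(1)[of k] by auto
      from 2[OF this(1)] 2[OF this(2)] show ?thesis
        unfolding f_def using \<mu>(1)[of k] by (intro holomorphic_intros) auto
    qed
    show "\<exists>B. \<forall>k. \<forall>\<zeta>\<in>Kc. norm (f k \<zeta>) \<le> B" if "compact Kc" "Kc \<subseteq> ball \<zeta>0 s" for Kc
    proof (intro exI allI ballI)
      fix k \<zeta> assume "\<zeta> \<in> Kc"
      then have \<zeta>: "\<zeta> \<in> ball \<zeta>0 s" using that by blast
      define B where "B = norm n * (M * norm e / (d / 2))"
      have "norm (cdot n (H (F (p + \<zeta> *s q) + of_real (\<mu> k) *s e)) - cdot n (H (F (p + \<zeta> *s q) + 0 *s e)))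
          \<le> B * norm (of_real (\<mu> k) - 0 :: complex)"
      proof (rule field_differentiable_bound[where S="cball 0 (\<mu> k)"])
        fix t assume "t \<in> cball (0::complex) (\<mu> k)"
        then have t: "norm t \<le> \<mu> k" by simp
        show "((\<lambda>t. cdot n (H (F (p + \<zeta> *s q) + t *s e))) has_field_derivative
            cdot n (cderiv H (F (p + \<zeta> *s q) + t *s e) e)) (at t within cball 0 (\<mu> k))"
          by (rule has_field_derivative_at_within[OF Hd[OF \<zeta> t]])
        have "norm (cdot n (cderiv H (F (p + \<zeta> *s q) + t *s e) e))
            \<le> norm n * (M * norm e / depth (F (p + \<zeta> *s q) + t *s e))"
          by (rule order_trans[OF norm_cdot_le mult_left_mono[OF M(2)]]) (use near[OF \<zeta> t] in auto)
        also have "\<dots> \<le> B"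
          unfolding B_def using near[OF \<zeta> t] d M(1)
          by (intro mult_left_mono divide_left_mono mult_nonneg_nonneg mult_pos_pos) auto
        finally show "norm (cdot n (cderiv H (F (p + \<zeta> *s q) + t *s e) e)) \<le> B" .
      qed (use \<mu>(1)[of k] in auto)
      then show "norm (f k \<zeta>) \<le> norm n * (M * norm e / (d / 2))"
        using \<mu>(1)[of k] by (simp add: f_def B_def norm_divide divide_le_eq)
    qed
    show "(\<lambda>k. f k \<zeta>) \<longlonglongrightarrow> cdot n (cderiv H (F (p + \<zeta> *s q)) e)" if \<zeta>: "\<zeta> \<in> ball \<zeta>0 s" for \<zeta>
    proof -
      have "((\<lambda>t. cdot n (H (F (p + \<zeta> *s q) + t *s e))) has_field_derivative
          cdot n (cderiv H (F (p + \<zeta> *s q)) e)) (at 0)"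
        using Hd[OF \<zeta>, of 0 0] \<mu>(1)[of 0] by simp
      then have 1: "((\<lambda>t. (cdot n (H (F (p + \<zeta> *s q) + t *s e)) - cdot n (H (F (p + \<zeta> *s q)))) / t)
          \<longlongrightarrow> cdot n (cderiv H (F (p + \<zeta> *s q)) e)) (at 0)"
        by (simp add: has_field_derivative_iff)
      have "(\<lambda>k. d / (2 * (norm e + 1)) * inverse (real (Suc k))) \<longlonglongrightarrow> d / (2 * (norm e + 1)) * 0"
        by (intro tendsto_intros LIMSEQ_inverse_real_of_nat)
      then have "\<mu> \<longlonglongrightarrow> 0" by (simp add: \<mu>_def[abs_def])
      then have "(\<lambda>k. of_real (\<mu> k) :: complex) \<longlonglongrightarrow> of_real 0" by (rule tendsto_of_real)
      then have 2: "filterlim (\<lambda>k. of_real (\<mu> k) :: complex) (at 0) sequentially"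
        using \<mu>(1) by (auto simp: filterlim_at less_imp_neq[symmetric])
      show ?thesis unfolding f_def by (rule filterlim_compose[OF 1 2])
    qed
  qed simp
  then show "(\<lambda>\<zeta>. cdot n (cderiv H (F (p + \<zeta> *s q)) e)) field_differentiable at \<zeta>0 within S"
    using s holomorphic_on_imp_differentiable_at field_differentiable_at_within
    by (metis centre_in_ball open_ball)
qed

section \<open>Recentring and the contradiction\<close>

lemma tilted_base_points:
  assumes y: "y \<in> C"
  obtains p l l0 \<epsilon> where "l \<longlonglongrightarrow> l0" and "\<epsilon> \<longlonglongrightarrow> (0::real)"
    and "\<And>j \<eta>. 1 / depth (F (cvec y (p j + \<eta>)))
           \<le> 2 * (1 / depth (F (cvec y (p j)))) * exp (l j \<bullet> \<eta> + \<epsilon> j * (norm \<eta>)\<^sup>2)"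
proof -
  obtain b where b: "0 \<le> b"
    "\<And>\<eta>. 1 / depth (F (cvec y \<eta>)) \<le> 1 / depth (F (cvec y 0)) * exp (b * norm \<eta> + 1)"
    using inverse_depth_growth[OF y] by blast
  have pos: "0 < 1 / depth (F (cvec y \<eta>))" for \<eta>
    using depth_pos[OF F(2)[OF cvec_in_tube[OF y]]] by simp
  obtain p l l0 \<epsilon> where "l \<longlonglongrightarrow> l0" "\<epsilon> \<longlonglongrightarrow> (0::real)"
    "\<And>j \<eta>. 1 / depth (F (cvec y (p j + \<eta>)))
           \<le> 2 * (1 / depth (F (cvec y (p j)))) * exp (l j \<bullet> \<eta> + \<epsilon> j * (norm \<eta>)\<^sup>2)"
    using exponential_tilt[where U="\<lambda>\<eta>. 1 / depth (F (cvec y \<eta>))", OF pos b(2,1)] by metis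
  then show ?thesis by (rule that)
qed

text \<open>The decay \<open>exp(-c L)\<close> beats the growth \<open>exp(L |l0 \<bullet> v|)\<close> of 1/depth at the points \<open>\<eta> \<pm> L v\<close>. The limit
in \<open>j\<close> has to be taken before \<open>L \<rightarrow> \<infinity>\<close>, since the tilt bound has the factor \<open>exp(\<epsilon> j |x|\<^sup>2)\<close>.\<close>

lemma normal_component_limit_mid:
  assumes y: "y \<in> C" and l: "l \<longlonglongrightarrow> l0" and \<epsilon>: "\<epsilon> \<longlonglongrightarrow> (0::real)"
    and tilt: "\<And>j \<eta>. 1 / depth (F (cvec y (p j + \<eta>)))
           \<le> 2 * (1 / depth (F (cvec y (p j)))) * exp (l j \<bullet> \<eta> + \<epsilon> j * (norm \<eta>)\<^sup>2)"
    and ch: "supporting_chord C n a v"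
    and c: "\<bar>l0 \<bullet> v\<bar> < c"
    and decay: "\<And>\<eta> L. 0 \<le> L \<Longrightarrow>
      norm (cdot n (cderiv H (F (cvec (a + (1/2) *\<^sub>R v) \<eta>)) e)) \<le>
        K * exp (- c * L) *
         (1 / depth (F (cvec (a + (1/2) *\<^sub>R v) (\<eta> + L *\<^sub>R v)))
          + 1 / depth (F (cvec (a + (1/2) *\<^sub>R v) (\<eta> - L *\<^sub>R v))))"
    and K: "0 \<le> K"
  shows "(\<lambda>j. cdot n (cderiv H (F (cvec (a + (1/2) *\<^sub>R v) (p j + \<eta>))) e) * of_real (depth (F (cvec y (p j))))) \<longlonglongrightarrow> 0"
proof -
  define m where "m = a + (1/2) *\<^sub>R v"
  have m: "m \<in> C" using ch by (simp add: m_def supporting_chord_def)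
  define U where "U j = 1 / depth (F (cvec y (p j)))" for j
  have dpos: "0 < depth (F (cvec y \<eta>))" for \<eta> using depth_pos[OF F(2)[OF cvec_in_tube[OF y]]] .
  obtain k where k: "0 < k" "\<And>\<eta>. 1 / depth (F (cvec m \<eta>)) \<le> k * (1 / depth (F (cvec y \<eta>)))"
  proof (rule depth_compare[of "{m}" y 0])
    fix k assume "0 < k" and k: "\<And>x \<eta> \<eta>' :: real ^ 'n. x \<in> {m} \<Longrightarrow> norm (\<eta>' - \<eta>) \<le> 0 \<Longrightarrow>
       1 / depth (F (cvec x \<eta>')) \<le> k * (1 / depth (F (cvec y \<eta>)))"
    have "1 / depth (F (cvec m \<eta>)) \<le> k * (1 / depth (F (cvec y \<eta>)))" for \<eta> by (rule k) simp_all
    then show thesis by (rule that[OF \<open>0 < k\<close>])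
  qed (use m y in auto)
  define E where "E j x = exp (l j \<bullet> x + \<epsilon> j * (norm x)\<^sup>2)" for j x
  have E: "1 / depth (F (cvec m (p j + x))) \<le> 2 * k * U j * E j x" for j x
  proof -
    have "1 / depth (F (cvec m (p j + x))) \<le> k * (1 / depth (F (cvec y (p j + x))))" by (rule k(2))
    also have "\<dots> \<le> k * (2 * U j * E j x)"
      unfolding U_def E_def using k(1) by (intro mult_left_mono tilt) auto
    finally show ?thesis by (simp add: mult_ac)
  qed
  define g where "g j = cdot n (cderiv H (F (cvec m (p j + \<eta>))) e) * of_real (depth (F (cvec y (p j))))" for j
  have g: "norm (g j) \<le> 2 * k * K * exp (- c * L) * (E j (\<eta> + L *\<^sub>R v) + E j (\<eta> - L *\<^sub>R v))"
    if L: "0 \<le> L" for j L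
  proof -
    have "norm (cdot n (cderiv H (F (cvec m (p j + \<eta>))) e)) \<le> K * exp (- c * L) *
        (1 / depth (F (cvec m (p j + (\<eta> + L *\<^sub>R v)))) + 1 / depth (F (cvec m (p j + (\<eta> - L *\<^sub>R v)))))"
      using decay[OF L, of "p j + \<eta>"] by (simp add: m_def add.assoc add_diff_eq)
    also have "\<dots> \<le> K * exp (- c * L) * (2 * k * U j * E j (\<eta> + L *\<^sub>R v) + 2 * k * U j * E j (\<eta> - L *\<^sub>R v))"
      using K by (intro mult_left_mono add_mono E) auto
    finally have "norm (cdot n (cderiv H (F (cvec m (p j + \<eta>))) e))
      \<le> (2 * k * K * exp (- c * L) * (E j (\<eta> + L *\<^sub>R v) + E j (\<eta> - L *\<^sub>R v))) * U j"
      by (simp add: algebra_simps)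
    then show ?thesis
      using dpos[of "p j"] by (simp add: g_def U_def norm_mult le_divide_eq)
  qed
  have limE: "(\<lambda>j. E j x) \<longlonglongrightarrow> exp (l0 \<bullet> x)" for x
  proof -
    have "(\<lambda>j. exp (l j \<bullet> x + \<epsilon> j * (norm x)\<^sup>2)) \<longlonglongrightarrow> exp (l0 \<bullet> x + 0 * (norm x)\<^sup>2)"
      by (intro tendsto_intros l \<epsilon>)
    then show ?thesis by (simp add: E_def)
  qed
  define b where "b = c - \<bar>l0 \<bullet> v\<bar>"
  have b: "b > 0" using c by (simp add: b_def)
  have "g \<longlonglongrightarrow> 0"
  proof (rule tendstoI)
    fix \<delta> :: real assume "\<delta> > 0"
    have "((\<lambda>L. (4 * k * K * exp (l0 \<bullet> \<eta>)) * exp (- (b * L))) \<longlongrightarrow> (4 * k * K * exp (l0 \<bullet> \<eta>)) * 0) at_top"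
      by (intro tendsto_intros filterlim_compose[OF exp_at_bot]
          filterlim_compose[OF filterlim_uminus_at_bot_at_top] filterlim_tendsto_pos_mult_at_top[OF tendsto_const b] filterlim_ident)
    then have "\<forall>\<^sub>F L in at_top. (4 * k * K * exp (l0 \<bullet> \<eta>)) * exp (- (b * L)) < \<delta>"
      using order_tendstoD(2) \<open>\<delta> > 0\<close> by fastforce
    then have "\<forall>\<^sub>F L in at_top. (4 * k * K * exp (l0 \<bullet> \<eta>)) * exp (- (b * L)) < \<delta> \<and> 0 \<le> L"
      using eventually_ge_at_top eventually_conj by blast
    then obtain L where L: "(4 * k * K * exp (l0 \<bullet> \<eta>)) * exp (- (b * L)) < \<delta>" "0 \<le> L"
      using eventually_happens by fastforce
    have lim: "(\<lambda>j. 2 * k * K * exp (- c * L) * (E j (\<eta> + L *\<^sub>R v) + E j (\<eta> - L *\<^sub>R v)))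
        \<longlonglongrightarrow> 2 * k * K * exp (- c * L) * (exp (l0 \<bullet> (\<eta> + L *\<^sub>R v)) + exp (l0 \<bullet> (\<eta> - L *\<^sub>R v)))"
      by (intro tendsto_intros limE)
    have side: "exp (l0 \<bullet> (\<eta> + s *\<^sub>R v)) \<le> exp (l0 \<bullet> \<eta> + L * \<bar>l0 \<bullet> v\<bar>)" if "\<bar>s\<bar> = L" for s
    proof -
      have "s * (l0 \<bullet> v) \<le> \<bar>s\<bar> * \<bar>l0 \<bullet> v\<bar>" by (metis abs_ge_self abs_mult)
      then show ?thesis using that by (simp add: inner_add_right)
    qed
    have "exp (l0 \<bullet> (\<eta> + L *\<^sub>R v)) + exp (l0 \<bullet> (\<eta> - L *\<^sub>R v)) \<le> 2 * exp (l0 \<bullet> \<eta> + L * \<bar>l0 \<bullet> v\<bar>)"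
      using add_mono[OF side[of L] side[of "- L"]] L(2) by (simp del: exp_le_cancel_iff)
    then have "2 * k * K * exp (- c * L) * (exp (l0 \<bullet> (\<eta> + L *\<^sub>R v)) + exp (l0 \<bullet> (\<eta> - L *\<^sub>R v)))
        \<le> 2 * k * K * exp (- c * L) * (2 * exp (l0 \<bullet> \<eta> + L * \<bar>l0 \<bullet> v\<bar>))"
      using k(1) K by (intro mult_left_mono) auto
    also have "\<dots> = (4 * k * K) * (exp (- c * L) * exp (l0 \<bullet> \<eta> + L * \<bar>l0 \<bullet> v\<bar>))"
      by (simp only: mult_ac)
    also have "exp (- c * L) * exp (l0 \<bullet> \<eta> + L * \<bar>l0 \<bullet> v\<bar>) = exp (l0 \<bullet> \<eta>) * exp (- (b * L))"
      by (simp add: exp_add[symmetric] b_def algebra_simps)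
    also have "(4 * k * K) * (exp (l0 \<bullet> \<eta>) * exp (- (b * L))) < \<delta>"
      using L(1) by (simp only: mult.assoc)
    finally have "2 * k * K * exp (- c * L) * (exp (l0 \<bullet> (\<eta> + L *\<^sub>R v)) + exp (l0 \<bullet> (\<eta> - L *\<^sub>R v))) < \<delta>" .
    from order_tendstoD(2)[OF lim this] have "\<forall>\<^sub>F j in sequentially. norm (g j) < \<delta>"
      by eventually_elim (rule le_less_trans[OF g[OF L(2)]])
    then show "\<forall>\<^sub>F j in sequentially. dist (g j) 0 < \<delta>" by simp
  qed
  then show ?thesis by (simp add: g_def[abs_def] m_def)
qed

text \<open>On the complex line through \<open>m\<close> and \<open>y\<close>, shifted by the base points, the functions are bounded by
Harnack's inequality and tend to 0 on the imaginary axis, which parametrises points over \<open>m\<close>. By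
Vitali's theorem they tend to 0 also at the parameter 1, which corresponds to \<open>y\<close>.\<close>

lemma normal_component_limit_transfer:
  assumes m: "m \<in> C" and y: "y \<in> C"
    and lim: "\<And>\<eta>. (\<lambda>j. cdot n (cderiv H (F (cvec m (p j + \<eta>))) e) * of_real (depth (F (cvec y (p j))))) \<longlonglongrightarrow> 0"
  shows "(\<lambda>j. cdot n (cderiv H (F (cvec y (p j))) e) * of_real (depth (F (cvec y (p j))))) \<longlonglongrightarrow> 0"
proof -
  define S where "S = {\<zeta>. m + Re \<zeta> *\<^sub>R (y - m) \<in> C}"
  define z where "z j \<zeta> = cvec m (p j) + \<zeta> *s cvec (y - m) 0" for j \<zeta>
  have zc: "z j \<zeta> = cvec (m + Re \<zeta> *\<^sub>R (y - m)) (p j + Im \<zeta> *\<^sub>R (y - m))" for j \<zeta>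
    by (simp add: z_def cvec_linear)
  have zt: "z j \<zeta> \<in> tube C" if "\<zeta> \<in> S" for j \<zeta>
    unfolding zc using that by (intro cvec_in_tube) (simp add: S_def)
  have openS: "open S"
  proof -
    have "open ((\<lambda>\<zeta>. m + Re \<zeta> *\<^sub>R (y - m)) -` C)"
      by (intro open_vimage C(1) continuous_intros)
    then show ?thesis by (simp add: S_def vimage_def)
  qed
  have "convex S"
  proof (rule convexI)
    fix \<zeta> \<omega> :: complex and u v :: real
    assume h: "\<zeta> \<in> S" "\<omega> \<in> S" "0 \<le> u" "0 \<le> v" "u + v = 1"
    then have "u *\<^sub>R (m + Re \<zeta> *\<^sub>R (y - m)) + v *\<^sub>R (m + Re \<omega> *\<^sub>R (y - m)) \<in> C"
      using C(2) unfolding S_def by (auto intro: convexD)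
    moreover have "u *\<^sub>R (m + Re \<zeta> *\<^sub>R (y - m)) + v *\<^sub>R (m + Re \<omega> *\<^sub>R (y - m))
        = m + Re (u *\<^sub>R \<zeta> + v *\<^sub>R \<omega>) *\<^sub>R (y - m)"
    proof -
      have "u *\<^sub>R m + v *\<^sub>R m = m" using h(5) by (metis scaleR_add_left scaleR_one)
      then show ?thesis by (simp add: scaleR_add_right scaleR_add_left add_ac)
    qed
    ultimately show "u *\<^sub>R \<zeta> + v *\<^sub>R \<omega> \<in> S" by (simp add: S_def)
  qed
  then have connS: "connected S" by (rule convex_connected)
  obtain M where M: "M > 0" "\<And>w e. w \<in> D \<Longrightarrow> norm (cderiv H w e) \<le> M * norm e / depth w"
    using cderiv_inverse_upper by blast
  define d where "d j = depth (F (cvec y (p j)))" for j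
  have d: "0 < d j" for j unfolding d_def using depth_pos[OF F(2)[OF cvec_in_tube[OF y]]] .
  define f where "f j \<zeta> = cdot n (cderiv H (F (z j \<zeta>)) e) * of_real (d j)" for j \<zeta>
  have "(\<lambda>j. f j 1) \<longlonglongrightarrow> 0"
  proof (rule vitali_tendsto_zero[OF openS connS])
    show "f j holomorphic_on S" for j
      unfolding f_def z_def
      by (intro holomorphic_intros holomorphic_cderiv_on_line openS) (use zt in \<open>simp add: z_def\<close>)
    show "\<exists>B. \<forall>j. \<forall>\<zeta>\<in>Kc. norm (f j \<zeta>) \<le> B" if Kc: "compact Kc" "Kc \<subseteq> S" for Kc
    proof -
      define X where "X = (\<lambda>\<zeta>. m + Re \<zeta> *\<^sub>R (y - m)) ` Kc"
      have "compact X" unfolding X_def by (intro compact_continuous_image continuous_intros Kc)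
      moreover have "X \<subseteq> C" using Kc(2) by (auto simp: X_def S_def)
      moreover obtain B where B: "\<And>\<zeta>. \<zeta> \<in> Kc \<Longrightarrow> norm \<zeta> \<le> B"
        using compact_imp_bounded[OF Kc(1)] unfolding bounded_iff by blast
      ultimately obtain k where k: "0 < k" "\<And>x \<eta> \<eta>'. x \<in> X \<Longrightarrow> norm (\<eta>' - \<eta>) \<le> B * norm (y - m) \<Longrightarrow>
          1 / depth (F (cvec x \<eta>')) \<le> k * (1 / depth (F (cvec y \<eta>)))"
        using depth_compare[of X y "B * norm (y - m)"] y by blast
      have "norm (f j \<zeta>) \<le> norm n * (M * norm e * k)" if \<zeta>: "\<zeta> \<in> Kc" for j \<zeta>
      proof -
        have "\<bar>Im \<zeta>\<bar> * norm (y - m) \<le> B * norm (y - m)"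
          using abs_Im_le_cmod[of \<zeta>] B[OF \<zeta>] by (intro mult_right_mono) auto
        then have 1: "1 / depth (F (z j \<zeta>)) \<le> k * (1 / d j)"
          unfolding zc d_def using \<zeta> by (intro k(2)) (auto simp: X_def)
        have "norm (f j \<zeta>) \<le> norm n * (M * norm e / depth (F (z j \<zeta>))) * d j"
          unfolding f_def norm_mult
          using d[of j] by (intro mult_mono order_trans[OF norm_cdot_le mult_left_mono[OF M(2)]] F(2) zt)
            (use \<zeta> Kc(2) M(1) depth_pos[OF F(2)[OF zt]] in \<open>auto simp: less_imp_le\<close>)
        also have "\<dots> = (norm n * (M * norm e) * d j) * (1 / depth (F (z j \<zeta>)))" by simp
        also have "\<dots> \<le> (norm n * (M * norm e) * d j) * (k * (1 / d j))"
          using M(1) d[of j] by (intro mult_left_mono 1) auto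
        also have "\<dots> = norm n * (M * norm e * k)" using d[of j] by simp
        finally show ?thesis .
      qed
      then show ?thesis by blast
    qed
    show "{\<zeta>. Re \<zeta> = 0} \<subseteq> S" "0 \<in> S" "1 \<in> S" using m y by (auto simp: S_def)
    show "0 islimpt {\<zeta>. Re \<zeta> = 0}"
      unfolding islimpt_approachable
    proof (intro allI impI)
      fix r :: real assume "r > 0"
      then show "\<exists>x'\<in>{\<zeta>. Re \<zeta> = 0}. x' \<noteq> 0 \<and> dist x' 0 < r"
        by (intro bexI[of _ "\<i> * of_real (r / 2)"]) (auto simp: norm_mult)
    qed
    show "(\<lambda>j. f j \<zeta>) \<longlonglongrightarrow> 0" if "\<zeta> \<in> {\<zeta>. Re \<zeta> = 0}" for \<zeta>
      using lim[of "Im \<zeta> *\<^sub>R (y - m)"] that by (simp add: f_def zc d_def)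
  qed
  then show ?thesis by (simp add: f_def zc d_def)
qed

text \<open>The limits for \<open>n0\<close> and \<open>n0 + (\<tau> / 2) e\<^sub>i\<close> differ by a multiple of the \<open>i\<close>-th coordinate, so every matrix
entry of \<open>H'\<close> times the depth tends to 0 along the base points, while the Koebe-type estimate
keeps the norm of this product at least \<open>r / 2\<close>.\<close>

lemma no_bounded_convex_model:
  assumes dim: "CARD('n) \<ge> 2" and sc: "strictly_convex C"
  shows False
proof -
  obtain y where y: "y \<in> C" using C(4) by blast
  obtain p l l0 \<epsilon> where tilt: "l \<longlonglongrightarrow> l0" "\<epsilon> \<longlonglongrightarrow> (0::real)"
    "\<And>j \<eta>. 1 / depth (F (cvec y (p j + \<eta>)))
           \<le> 2 * (1 / depth (F (cvec y (p j)))) * exp (l j \<bullet> \<eta> + \<epsilon> j * (norm \<eta>)\<^sup>2)"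
    by (rule tilted_base_points[OF y]) (rule that)
  obtain c K \<rho> where c: "0 < c" and K: "0 < K" and \<rho>: "0 < \<rho>"
    and decay: "\<And>n a v \<eta> e L. supporting_chord C n a v \<Longrightarrow> norm e < \<rho> \<Longrightarrow> 0 \<le> L \<Longrightarrow>
      norm (cdot n (cderiv H (F (cvec (a + (1/2) *\<^sub>R v) \<eta>)) e)) \<le>
        K * norm n * exp (- c * L) *
         (1 / depth (F (cvec (a + (1/2) *\<^sub>R v) (\<eta> + L *\<^sub>R v)))
          + 1 / depth (F (cvec (a + (1/2) *\<^sub>R v) (\<eta> - L *\<^sub>R v))))"
    by (rule normal_component_decay) (rule that)
  obtain n0 \<tau> where \<tau>: "\<tau> > 0"
    "\<And>n'. norm (n' - n0) < \<tau> \<Longrightarrow> \<exists>a v. supporting_chord C n' a v \<and> \<bar>l0 \<bullet> v\<bar> < c"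
    using supporting_chords_nearly_orthogonal[OF dim C sc c, of l0] by metis
  define w where "w j = F (cvec y (p j))" for j
  have w: "w j \<in> D" for j unfolding w_def by (rule F(2)[OF cvec_in_tube[OF y]])
  have lim: "(\<lambda>j. cdot n (cderiv H (w j) e) * of_real (depth (w j))) \<longlonglongrightarrow> 0"
    if n: "norm (n - n0) < \<tau>" and e: "norm e < \<rho>" for n e
  proof -
    obtain a v where ch: "supporting_chord C n a v" "\<bar>l0 \<bullet> v\<bar> < c" using \<tau>(2)[OF n] by blast
    have m: "a + (1/2) *\<^sub>R v \<in> C" using ch(1) by (simp add: supporting_chord_def)
    show ?thesis unfolding w_def
    proof (rule normal_component_limit_transfer[OF m y])
      fix \<eta>
      show "(\<lambda>j. cdot n (cderiv H (F (cvec (a + (1/2) *\<^sub>R v) (p j + \<eta>))) e) * of_real (depth (F (cvec y (p j))))) \<longlonglongrightarrow> 0"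
        by (rule normal_component_limit_mid[OF y tilt ch decay[OF ch(1) e]]) (use K in auto)
    qed
  qed
  have comp: "(\<lambda>j. (cderiv H (w j) (axis k 1) $ i) * of_real (depth (w j))) \<longlonglongrightarrow> 0" for k i
  proof -
    \<comment> \<open>Scaled to satisfy \<open>norm e < \<rho>\<close>; the factor is divided out below.\<close>
    define e :: "complex ^ 'n" where "e = of_real (\<rho> / 2) *s axis k 1"
    have e: "norm e < \<rho>" using \<rho> by (simp add: e_def norm_cscale)
    have 1: "norm (n0 - n0) < \<tau>" "norm ((n0 + (\<tau> / 2) *\<^sub>R axis i 1) - n0) < \<tau>" using \<tau>(1) by auto
    have "(\<lambda>j. (cdot (n0 + (\<tau> / 2) *\<^sub>R axis i 1) (cderiv H (w j) e) * of_real (depth (w j))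
         - cdot n0 (cderiv H (w j) e) * of_real (depth (w j))) / of_real (\<tau> / 2 * (\<rho> / 2))) \<longlonglongrightarrow> (0 - 0) / of_real (\<tau> / 2 * (\<rho> / 2))"
      by (intro tendsto_intros lim 1 e) (use \<tau>(1) \<rho> in auto)
    moreover have "(cdot (n0 + (\<tau> / 2) *\<^sub>R axis i 1) (cderiv H (w j) e) * of_real (depth (w j))
         - cdot n0 (cderiv H (w j) e) * of_real (depth (w j))) / of_real (\<tau> / 2 * (\<rho> / 2))
       = (cderiv H (w j) (axis k 1) $ i) * of_real (depth (w j))" for j
    proof -
      have "cderiv H (w j) e = of_real (\<rho> / 2) *s cderiv H (w j) (axis k 1)"
        unfolding e_def by (rule cderiv(2)[OF H(1) w])
      then have "cdot (n0 + (\<tau> / 2) *\<^sub>R axis i 1) (cderiv H (w j) e)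
          = cdot n0 (cderiv H (w j) e) + of_real (\<tau> / 2 * (\<rho> / 2)) * (cderiv H (w j) (axis k 1) $ i)"
        by (simp add: cdot_linear cdot_axis distrib_left)
      moreover have "(of_real (\<tau> / 2 * (\<rho> / 2)) :: complex) \<noteq> 0" using \<tau>(1) \<rho> by auto
      ultimately show ?thesis by (simp only:) (simp only: distrib_right add_diff_cancel_left' mult.assoc nonzero_mult_div_cancel_left not_False_eq_True)
    qed
    ultimately show ?thesis by simp
  qed
  obtain r where r: "0 < r" "ball y r \<subseteq> C" using y C(1) openE by blast
  define T where "T j = (\<Sum>k\<in>UNIV. \<Sum>i\<in>UNIV. norm ((cderiv H (w j) (axis k 1) $ i) * of_real (depth (w j))))" for j
  have "T \<longlonglongrightarrow> (\<Sum>k\<in>(UNIV::'n set). \<Sum>i\<in>(UNIV::'n set). 0)"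
    unfolding T_def by (intro tendsto_sum tendsto_norm_zero comp)
  then have T0: "T \<longlonglongrightarrow> 0" by simp
  have "r / 2 \<le> T j" for j
  proof -
    have bt: "ball (cvec y (p j)) r \<subseteq> tube C" by (rule ball_subset_tube) (simp add: r)
    obtain e where e: "norm e = 1" "r / (2 * depth (w j)) \<le> norm (cderiv H (w j) e)"
      using cderiv_inverse_lower[OF r(1) bt] unfolding w_def by blast
    have dw: "0 < depth (w j)" by (rule depth_pos[OF w])
    have lin: "linear (cderiv H (w j))" using cderiv(1)[OF H(1) w] has_derivative_linear by blast
    have "cderiv H (w j) e = cderiv H (w j) (\<Sum>k\<in>UNIV. (e $ k) *s axis k 1)"
      by (simp add: basis_expansion)
    also have "\<dots> = (\<Sum>k\<in>UNIV. (e $ k) *s cderiv H (w j) (axis k 1))"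
      by (simp add: linear_sum[OF lin] cderiv(2)[OF H(1) w])
    finally have "norm (cderiv H (w j) e) \<le> (\<Sum>k\<in>UNIV. norm (e $ k) * norm (cderiv H (w j) (axis k 1)))"
      by (metis (mono_tags, lifting) norm_cscale norm_sum sum.cong)
    also have "\<dots> \<le> (\<Sum>k\<in>UNIV. 1 * (\<Sum>i\<in>UNIV. norm (cderiv H (w j) (axis k 1) $ i)))"
    proof (intro sum_mono mult_mono)
      show "norm (e $ k) \<le> 1" for k using Finite_Cartesian_Product.norm_nth_le[of e k] e(1) by simp
      show "norm (cderiv H (w j) (axis k 1)) \<le> (\<Sum>i\<in>UNIV. norm (cderiv H (w j) (axis k 1) $ i))" for k
        unfolding norm_vec_def by (rule L2_set_le_sum) auto
    qed auto
    finally have "norm (cderiv H (w j) e) * depth (w j) \<le> T j"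
      using dw unfolding T_def
      by (simp add: norm_mult sum_distrib_right[symmetric] mult_right_mono)
    moreover have "r / 2 \<le> norm (cderiv H (w j) e) * depth (w j)"
      using e(2) dw by (simp add: field_simps)
    ultimately show ?thesis by linarith
  qed
  then have "r / 2 \<le> 0" by (intro LIMSEQ_le_const[OF T0]) auto
  then show False using r(1) by simp
qed

end

theorem corollary1p3:
  fixes C :: "(real ^ 'n) set"
  assumes "CARD('n) \<ge> 2"
    and "is_domain C" and "bounded C" and "convex C"
    and "real_analytic_hypersurface (frontier C)"
  shows "\<not> (\<exists>D :: (complex ^ 'n) set.
           is_domain D \<and> bounded D \<and> convex D \<and> biholomorphic (tube C) D)"
proof
  assume "\<exists>D :: (complex ^ 'n) set.
           is_domain D \<and> bounded D \<and> convex D \<and> biholomorphic (tube C) D"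
  then obtain D :: "(complex ^ 'n) set" and F H
    where D: "is_domain D" "bounded D" "convex D"
      and FH: "holomorphic_map_on F (tube C)" "holomorphic_map_on H D"
        "F ` tube C \<subseteq> D" "H ` D \<subseteq> tube C"
        "\<forall>z\<in>tube C. H (F z) = z" "\<forall>w\<in>D. F (H w) = w"
    unfolding biholomorphic_def by blast
  interpret tube_onto_convex C D F H
    by unfold_locales (use assms D FH in \<open>auto simp: is_domain_def\<close>)
  have "strictly_convex C"
    using C(1-3) assms(5) by (rule analytic_boundary_imp_strictly_convex)
  then show False by (rule no_bounded_convex_model[OF assms(1)])
qed

end
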